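(* Let $G=(V,E)$ be a finite undirected graph with at least one edge, and let $\beta\in(0,\infty)$. Fix $t>0$, and suppose the Edwards-Anderson Hamiltonian on $G$ is continuously perturbed up to time $t$. Let $\sigma^1$ be chosen from the original Gibbs measure at inverse temperature $\beta$ and $\sigma^2$ from the perturbed Gibbs measure at inverse temperature $\beta$, and let $Q_{1,2}$ be their bond overlap. Then $$\mathbb{E}\bigl\langle(Q_{1,2}-\langle Q_{1,2}\rangle)^2\bigr\rangle\le\frac{2}{\beta e^{-t/2}\sqrt{t|E|}}.$$
   Context: The Edwards-Anderson Hamiltonian on $G$ is $H(\sigma)=-\sum_{(i,j)\in E}g_{ij}\sigma_i\sigma_j$, $\sigma\in\{-1,1\}^V$, where $(g_{ij})_{(i,j)\in E}$ are i.i.d. standard Gaussian random variables, one per edge. The Gibbs measure at inverse temperature $\beta$ gives mass proportional to $e^{-\beta H(\sigma)}$ to $\sigma$. Continuous perturbation up to time $t$ means replacing each $g_{ij}$ by $e^{-t}g_{ij}+\sqrt{1-e^{-2t}}\,g'_{ij}$, where $(g'_{ij})$ is an independent copy of $(g_{ij})$; the perturbed Gibbs measure uses these couplings. Given $(g_{ij})$ and $(g'_{ij})$, $\sigma^1$ and $\sigma^2$ are drawn independently, and $\langle\cdot\rangle$ denotes the average over $(\sigma^1,\sigma^2)$ given the couplings $(g_{ij}),(g_{ij}')$, i.e. with respect to the product of the two Gibbs measures; $\mathbb{E}$ is then the expectation over the couplings. The bond overlap is $Q_{1,2}:=\frac1{|E|}\sum_{(i,j)\in E}\sigma^1_i\sigma^1_j\sigma^2_i\sigma^2_j$.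 *)

theory Defs
  imports "HOL-Probability.Probability"
begin

text \<open>Finite undirected graphs, with an edge between \<open>i\<close> and \<open>j\<close> encoded as the
  two-element set \<open>{i, j}\<close>. Isolated vertices are allowed.\<close>

definition finite_graph :: "'v set \<Rightarrow> 'v set set \<Rightarrow> bool" where
  "finite_graph V E \<longleftrightarrow> finite V \<and> (\<forall>e\<in>E. \<exists>i\<in>V. \<exists>j\<in>V. i \<noteq> j \<and> e = {i, j})"

definition spin_configs :: "'v set \<Rightarrow> ('v \<Rightarrow> real) set" where
  "spin_configs V = (\<Pi>\<^sub>E v\<in>V. {-1, 1})"

text \<open>For an edge \<open>e = {i, j}\<close> this is \<open>\<sigma> i * \<sigma> j\<close>; see \<open>bond_doubleton\<close> below.\<close>

definition bond :: "('v \<Rightarrow> real) \<Rightarrow> 'v set \<Rightarrow> real" where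
  "bond \<sigma> e = (\<Prod>v\<in>e. \<sigma> v)"

lemma bond_doubleton: "i \<noteq> j \<Longrightarrow> bond \<sigma> {i, j} = \<sigma> i * \<sigma> j"
  by (simp add: bond_def)

definition ea_hamiltonian :: "'v set set \<Rightarrow> ('v set \<Rightarrow> real) \<Rightarrow> ('v \<Rightarrow> real) \<Rightarrow> real" where
  "ea_hamiltonian E g \<sigma> = - (\<Sum>e\<in>E. g e * bond \<sigma> e)"

definition partition_function :: "'v set \<Rightarrow> 'v set set \<Rightarrow> real \<Rightarrow> ('v set \<Rightarrow> real) \<Rightarrow> real" where
  "partition_function V E \<beta> g = (\<Sum>\<sigma>\<in>spin_configs V. exp (- \<beta> * ea_hamiltonian E g \<sigma>))"

text \<open>\<^const>\<open>embed_pmf\<close> is meaningful only for nonnegative weights of total mass one;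
  \<open>pmf_gibbs\<close> below shows that this holds whenever \<open>V\<close> is finite.\<close>

definition gibbs :: "'v set \<Rightarrow> 'v set set \<Rightarrow> real \<Rightarrow> ('v set \<Rightarrow> real) \<Rightarrow> ('v \<Rightarrow> real) pmf" where
  "gibbs V E \<beta> g = embed_pmf (\<lambda>\<sigma>. if \<sigma> \<in> spin_configs V
     then exp (- \<beta> * ea_hamiltonian E g \<sigma>) / partition_function V E \<beta> g else 0)"

lemma finite_spin_configs: "finite V \<Longrightarrow> finite (spin_configs V)"
  by (simp add: spin_configs_def finite_PiE)

lemma spin_configs_nonempty: "spin_configs V \<noteq> {}"
  by (simp add: spin_configs_def PiE_eq_empty_iff)

lemma partition_function_pos:
  assumes "finite V"
  shows "partition_function V E \<beta> g > 0"
  unfolding partition_function_def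
  using assms by (intro sum_pos finite_spin_configs spin_configs_nonempty) auto

lemma pmf_gibbs:
  assumes "finite V"
  shows "pmf (gibbs V E \<beta> g) \<sigma> = (if \<sigma> \<in> spin_configs V
     then exp (- \<beta> * ea_hamiltonian E g \<sigma>) / partition_function V E \<beta> g else 0)"
proof -
  let ?Z = "partition_function V E \<beta> g"
  let ?w = "\<lambda>\<sigma>. exp (- \<beta> * ea_hamiltonian E g \<sigma>) / ?Z"
  let ?p = "\<lambda>\<sigma>. if \<sigma> \<in> spin_configs V then ?w \<sigma> else 0"
  have Z: "?Z > 0" using assms by (rule partition_function_pos)
  have fin: "finite (spin_configs V)" using assms by (rule finite_spin_configs)
  have "(\<integral>\<^sup>+\<sigma>. ennreal (?p \<sigma>) \<partial>count_space UNIV)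
      = (\<Sum>\<sigma>\<in>spin_configs V. ennreal (?p \<sigma>))"
    by (rule nn_integral_count_space') (use fin in auto)
  also have "\<dots> = ennreal (\<Sum>\<sigma>\<in>spin_configs V. ?w \<sigma>)"
    using Z by (subst sum_ennreal[symmetric]) auto
  also have "(\<Sum>\<sigma>\<in>spin_configs V. ?w \<sigma>) = 1"
    using Z by (simp add: sum_divide_distrib[symmetric] partition_function_def)
  finally show ?thesis
    unfolding gibbs_def using Z by (subst pmf_embed_pmf) auto
qed

definition perturb ::
    "real \<Rightarrow> ('v set \<Rightarrow> real) \<Rightarrow> ('v set \<Rightarrow> real) \<Rightarrow> 'v set \<Rightarrow> real" where
  "perturb t g g' e = exp (- t) * g e + sqrt (1 - exp (- 2 * t)) * g' e"

definition bond_overlap :: "'v set set \<Rightarrow> ('v \<Rightarrow> real) \<Rightarrow> ('v \<Rightarrow> real) \<Rightarrow> real" where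
  "bond_overlap E \<sigma>1 \<sigma>2 = (\<Sum>e\<in>E. bond \<sigma>1 e * bond \<sigma>2 e) / real (card E)"

text \<open>The quenched average \<open>\<langle>f (\<sigma>1, \<sigma>2)\<rangle>\<close>, for fixed couplings \<open>g\<close> and \<open>g'\<close>.\<close>

definition quenched_avg :: "'v set \<Rightarrow> 'v set set \<Rightarrow> real \<Rightarrow> real \<Rightarrow> ('v set \<Rightarrow> real) \<Rightarrow>
    ('v set \<Rightarrow> real) \<Rightarrow> (('v \<Rightarrow> real) \<Rightarrow> ('v \<Rightarrow> real) \<Rightarrow> real) \<Rightarrow> real" where
  "quenched_avg V E \<beta> t g g' f = measure_pmf.expectation
     (pair_pmf (gibbs V E \<beta> g) (gibbs V E \<beta> (perturb t g g'))) (\<lambda>(\<sigma>1, \<sigma>2). f \<sigma>1 \<sigma>2)"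

text \<open>The families \<open>g\<close> and \<open>g'\<close> together consist of independent standard Gaussians: in the
  disjoint sum of the index set with itself, \<^const>\<open>Inl\<close> marks \<open>g\<close> and \<^const>\<open>Inr\<close> marks \<open>g'\<close>.\<close>

definition iid_gaussian_pair ::
    "'a measure \<Rightarrow> 'i set \<Rightarrow> ('i \<Rightarrow> 'a \<Rightarrow> real) \<Rightarrow> ('i \<Rightarrow> 'a \<Rightarrow> real) \<Rightarrow> bool" where
  "iid_gaussian_pair M I g g' \<longleftrightarrow>
     prob_space.indep_vars M (\<lambda>_. borel) (case_sum g g') (I <+> I) \<and>
     (\<forall>i\<in>I. distributed M lborel (g i) std_normal_density) \<and>
     (\<forall>i\<in>I. distributed M lborel (g' i) std_normal_density)"

end

theory Submission
  imports Defs "HOL-Real_Asymp.Real_Asymp"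
begin

text \<open>Write \<open>h = a g + b g'\<close> with \<open>a = exp (- t)\<close>, \<open>b\<^sup>2 = 1 - a\<^sup>2\<close> for the perturbed couplings, and for
  couplings \<open>v\<close> let \<open>m\<^sub>e v\<close> and \<open>A\<^sub>e\<^sub>f v\<close> be the Gibbs averages of one bond and of a product of two bonds.
  With \<open>C\<^sub>e\<^sub>f = A\<^sub>e\<^sub>f - m\<^sub>e m\<^sub>f\<close>, the quenched variance of the overlap is
  \<open>1 / (card E)\<^sup>2\<close> times the sum over \<open>e\<close>, \<open>f\<close> of \<open>A\<^sub>e\<^sub>f h * C\<^sub>e\<^sub>f g + m\<^sub>e g * m\<^sub>f g * C\<^sub>e\<^sub>f h\<close>. Since \<open>\<beta> C\<^sub>e\<^sub>f\<close> is the
  derivative of \<open>m\<^sub>f\<close> in the \<open>e\<close>-th coupling, Gaussian integration by parts in the direction orthogonal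
  to the couplings of the other factor \<open>B\<^sub>e\<close> trades \<open>\<beta> b C\<^sub>e\<^sub>f\<close> for \<open>w\<^sub>e m\<^sub>f\<close>, where \<open>w\<close> is a standard Gaussian
  family independent of the argument of \<open>B\<^sub>e\<close>. As \<open>m\<^sub>f\<close> and \<open>B\<^sub>e\<close> are bounded by one, the sum over \<open>e\<close> has
  expectation at most \<open>sqrt (card E)\<close>. This gives the bound \<open>2 / (\<beta> b sqrt (card E))\<close>, and
  \<open>b\<^sup>2 \<ge> 1 - exp (- t) \<ge> t exp (- t)\<close>.\<close>

subsection \<open>Gaussian integration by parts\<close>

abbreviation std_gauss :: "real measure" where
  "std_gauss \<equiv> density lborel (\<lambda>x. ennreal (std_normal_density x))"

lemma prob_space_std_gauss: "prob_space std_gauss"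
  by (rule prob_space_normal_density) simp

lemma integrable_std_gauss_power: "integrable std_gauss (\<lambda>x. x ^ k)"
  by (subst integrable_density)
     (auto simp: integrable_std_normal_moment)

lemma std_normal_density_derivative:
  "(std_normal_density has_real_derivative - x * std_normal_density x) (at x)"
  unfolding std_normal_density_def
  by (auto intro!: derivative_eq_intros simp: field_simps)

text \<open>Removes the boundary terms at both infinities in the one-dimensional integration by
  parts, where the function is controlled only up to linear growth.\<close>

lemma std_normal_density_linear_tendsto:
  "((\<lambda>x. std_normal_density x * (K * (1 + \<bar>x\<bar>))) \<longlongrightarrow> 0) at_top"
  "((\<lambda>x. std_normal_density x * (K * (1 + \<bar>x\<bar>))) \<longlongrightarrow> 0) at_bot"
proof -
  have "((\<lambda>x. std_normal_density x * (1 + \<bar>x\<bar>)) \<longlongrightarrow> 0) at_top"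
    unfolding std_normal_density_def by real_asymp
  moreover have "((\<lambda>x. std_normal_density x * (1 + \<bar>x\<bar>)) \<longlongrightarrow> 0) at_bot"
    unfolding std_normal_density_def by real_asymp
  ultimately show "((\<lambda>x. std_normal_density x * (K * (1 + \<bar>x\<bar>))) \<longlongrightarrow> 0) at_top"
    "((\<lambda>x. std_normal_density x * (K * (1 + \<bar>x\<bar>))) \<longlongrightarrow> 0) at_bot"
    by (auto simp: mult.left_commute[of _ K] intro: tendsto_mult_right_zero)
qed

text \<open>Stein's identity. The density times \<open>f\<close> has as derivative the density times
  \<open>f' x - x * f x\<close>, and it tends to zero at both ends, so this derivative integrates to
  zero over the line.\<close>

lemma gaussian_integration_by_parts:
  fixes f f' :: "real \<Rightarrow> real"
  assumes deriv: "\<And>x. (f has_real_derivative f' x) (at x)"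
    and cont: "continuous_on UNIV f'"
    and f_le: "\<And>x. \<bar>f x\<bar> \<le> K * (1 + \<bar>x\<bar>)" and f'_le: "\<And>x. \<bar>f' x\<bar> \<le> K * (1 + \<bar>x\<bar>)"
  shows "(\<integral>x. x * f x \<partial>std_gauss) = (\<integral>x. f' x \<partial>std_gauss)"
proof -
  let ?\<phi> = std_normal_density
  have contf: "continuous_on UNIV f"
    using deriv DERIV_isCont by (blast intro: continuous_at_imp_continuous_on)
  have [measurable]: "f \<in> borel_measurable borel" "f' \<in> borel_measurable borel"
    using contf cont by (auto intro: borel_measurable_continuous_onI)
  have i1: "integrable lborel (\<lambda>x. ?\<phi> x * f' x)"
  proof (rule Bochner_Integration.integrable_bound)
    show "integrable lborel (\<lambda>x. K * (?\<phi> x * \<bar>x\<bar>^0) + K * (?\<phi> x * \<bar>x\<bar>^1))"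
      using integrable_std_normal_moment_abs by (intro Bochner_Integration.integrable_add integrable_mult_right)
    show "AE x in lborel. norm (?\<phi> x * f' x) \<le> norm (K * (?\<phi> x * \<bar>x\<bar>^0) + K * (?\<phi> x * \<bar>x\<bar>^1))"
    proof (rule AE_I2)
      fix x
      have "norm (?\<phi> x * f' x) \<le> ?\<phi> x * (K * (1 + \<bar>x\<bar>))"
        using f'_le[of x] by (auto simp: abs_mult intro: mult_left_mono)
      also have "\<dots> = K * (?\<phi> x * \<bar>x\<bar>^0) + K * (?\<phi> x * \<bar>x\<bar>^1)"
        by (simp add: algebra_simps)
      finally show "norm (?\<phi> x * f' x) \<le> norm (K * (?\<phi> x * \<bar>x\<bar>^0) + K * (?\<phi> x * \<bar>x\<bar>^1))"
        by simp
    qed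
  qed simp
  \<comment> \<open>The extra factor \<open>x\<close> raises the growth to degree two, so the second
    absolute moment enters the dominating function.\<close>
  have i2: "integrable lborel (\<lambda>x. ?\<phi> x * (x * f x))"
  proof (rule Bochner_Integration.integrable_bound)
    show "integrable lborel (\<lambda>x. K * (?\<phi> x * \<bar>x\<bar>^1) + K * (?\<phi> x * \<bar>x\<bar>^2))"
      using integrable_std_normal_moment_abs by (intro Bochner_Integration.integrable_add integrable_mult_right)
    show "AE x in lborel. norm (?\<phi> x * (x * f x)) \<le> norm (K * (?\<phi> x * \<bar>x\<bar>^1) + K * (?\<phi> x * \<bar>x\<bar>^2))"
    proof (rule AE_I2)
      fix x
      have "norm (?\<phi> x * (x * f x)) \<le> ?\<phi> x * (\<bar>x\<bar> * (K * (1 + \<bar>x\<bar>)))"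
        using f_le[of x] by (auto simp: abs_mult intro!: mult_left_mono)
      also have "\<dots> = K * (?\<phi> x * \<bar>x\<bar>^1) + K * (?\<phi> x * \<bar>x\<bar>^2)"
        by (simp add: algebra_simps power2_eq_square)
      finally show "norm (?\<phi> x * (x * f x)) \<le> norm (K * (?\<phi> x * \<bar>x\<bar>^1) + K * (?\<phi> x * \<bar>x\<bar>^2))"
        by simp
    qed
  qed simp
  have lim: "((\<lambda>x. ?\<phi> x * f x) \<longlongrightarrow> 0) F"
    if "((\<lambda>x. ?\<phi> x * (K * (1 + \<bar>x\<bar>))) \<longlongrightarrow> 0) F" for F
    using f_le by (intro Lim_null_comparison[OF _ that] always_eventually)
      (auto simp: abs_mult intro!: mult_left_mono)
  have "(LBINT x=-\<infinity>..\<infinity>. ?\<phi> x * f' x - ?\<phi> x * (x * f x)) = 0 - 0"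
  proof (rule interval_integral_FTC_integrable)
    show "((\<lambda>x. ?\<phi> x * f x) has_vector_derivative (?\<phi> x * f' x - ?\<phi> x * (x * f x))) (at x)" for x
      unfolding has_real_derivative_iff_has_vector_derivative[symmetric]
      by (auto intro!: derivative_eq_intros std_normal_density_derivative deriv simp: algebra_simps)
    show "isCont (\<lambda>x. ?\<phi> x * f' x - ?\<phi> x * (x * f x)) x" for x
      using contf cont std_normal_density_derivative[THEN DERIV_isCont]
      by (intro continuous_intros) (auto simp: continuous_on_eq_continuous_at)
    show "set_integrable lborel (einterval (-\<infinity>) \<infinity>) (\<lambda>x. ?\<phi> x * f' x - ?\<phi> x * (x * f x))"
      using i1 i2 by (auto simp: set_integrable_def)
    show "(((\<lambda>x. ?\<phi> x * f x) \<circ> real_of_ereal) \<longlongrightarrow> 0) (at_right (-\<infinity>))"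
      unfolding ereal_tendsto_simps by (intro lim std_normal_density_linear_tendsto)
    show "(((\<lambda>x. ?\<phi> x * f x) \<circ> real_of_ereal) \<longlongrightarrow> 0) (at_left \<infinity>)"
      unfolding ereal_tendsto_simps by (intro lim std_normal_density_linear_tendsto)
  qed simp
  then have "(\<integral>x. ?\<phi> x * f' x - ?\<phi> x * (x * f x) \<partial>lborel) = 0"
    by (simp add: interval_integral_to_infinity_eq interval_lebesgue_integral_def set_lebesgue_integral_def)
  then have "(\<integral>x. ?\<phi> x * f' x \<partial>lborel) = (\<integral>x. ?\<phi> x * (x * f x) \<partial>lborel)"
    using i1 i2 by simp
  then show ?thesis
    by (simp add: integral_density)
qed

section \<open>Integration by parts under product Gaussian measures\<close>

definition gauss_product :: "'i set \<Rightarrow> ('i \<Rightarrow> real) measure" where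
  "gauss_product I = PiM I (\<lambda>_. std_gauss)"

lemma prob_space_gauss_product: "prob_space (gauss_product I)"
  unfolding gauss_product_def by (intro prob_space_PiM prob_space_std_gauss)

lemma sets_gauss_product [measurable_cong]: "sets (gauss_product I) = sets (PiM I (\<lambda>_. borel))"
  unfolding gauss_product_def by (intro sets_PiM_cong) auto

lemma measurable_gauss_product_component:
  "i \<in> I \<Longrightarrow> (\<lambda>x. x i) \<in> borel_measurable (gauss_product I)"
  by measurable

lemma integrable_gauss_product_square:
  assumes "i \<in> I"
  shows "integrable (gauss_product I) (\<lambda>x. (x i)\<^sup>2)"
proof -
  have "distr (gauss_product I) std_gauss (\<lambda>x. x i) = std_gauss"
    unfolding gauss_product_def
    by (rule distr_PiM_component) (use assms prob_space_std_gauss in auto)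
  then have "integrable (distr (gauss_product I) std_gauss (\<lambda>x. x i)) (\<lambda>x. x\<^sup>2)"
    using integrable_std_gauss_power[of 2] by simp
  then show ?thesis
    using assms by (subst (asm) integrable_distr_eq) auto
qed

text \<open>With \<open>S\<close> the sum of the absolute coordinates,
  \<open>(1 + S)^2 <= 2 + 2 * S^2\<close> and Cauchy-Schwarz bound the growth by a multiple of the
  sum of squares, leaving only second moments of single coordinates.\<close>

lemma integrable_quadratic_growth:
  fixes F :: "('i \<Rightarrow> real) \<Rightarrow> real"
  assumes [measurable]: "F \<in> borel_measurable (gauss_product I)"
    and "finite I" and F_le: "\<And>x. \<bar>F x\<bar> \<le> K * (1 + (\<Sum>j\<in>I. \<bar>x j\<bar>))\<^sup>2"
  shows "integrable (gauss_product I) F"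
proof -
  interpret prob_space "gauss_product I" by (rule prob_space_gauss_product)
  define S where "S x = (\<Sum>j\<in>I. \<bar>x j\<bar>)" for x :: "'i \<Rightarrow> real"
  define Q where "Q x = \<bar>K\<bar> * (2 + 2 * (real (card I) * (\<Sum>j\<in>I. (x j)\<^sup>2)))" for x :: "'i \<Rightarrow> real"
  have "integrable (gauss_product I) Q"
    unfolding Q_def
    by (intro integrable_mult_right Bochner_Integration.integrable_add integrable_const
        Bochner_Integration.integrable_sum integrable_gauss_product_square)
  moreover have "norm (F x) \<le> norm (Q x)" for x
  proof -
    have "(S x)\<^sup>2 \<le> real (card I) * (\<Sum>j\<in>I. (x j)\<^sup>2)"
      using Cauchy_Schwarz_ineq_sum[of "\<lambda>_. 1" "\<lambda>j. \<bar>x j\<bar>" I] by (simp add: S_def)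
    moreover have "(1 + S x)\<^sup>2 \<le> 2 + 2 * (S x)\<^sup>2"
      using sum_squares_bound[of 1 "S x"] by (simp add: power2_sum)
    ultimately have "(1 + S x)\<^sup>2 \<le> 2 + 2 * (real (card I) * (\<Sum>j\<in>I. (x j)\<^sup>2))"
      by linarith
    then have "\<bar>K\<bar> * (1 + S x)\<^sup>2 \<le> Q x"
      unfolding Q_def by (rule mult_left_mono) simp
    moreover have "K * (1 + S x)\<^sup>2 \<le> \<bar>K\<bar> * (1 + S x)\<^sup>2"
      by (rule mult_right_mono) simp_all
    moreover have "\<bar>F x\<bar> \<le> K * (1 + S x)\<^sup>2"
      unfolding S_def by (rule F_le)
    ultimately show ?thesis unfolding real_norm_def by linarith
  qed
  ultimately show ?thesis
    using assms(1) by (intro Bochner_Integration.integrable_bound[of _ Q F] AE_I2)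
qed

text \<open>Fubini isolates the coordinate \<open>i\<close>; for each choice of the other
  coordinates the one-dimensional identity applies to the inner integral.\<close>

lemma gauss_product_integration_by_parts:
  assumes I: "finite I" "i \<in> I"
    and [measurable]: "F \<in> borel_measurable (gauss_product I)" "F' \<in> borel_measurable (gauss_product I)"
    and deriv: "\<And>x y. ((\<lambda>y. F (x(i := y))) has_real_derivative F' (x(i := y))) (at y)"
    and cont: "\<And>x. continuous_on UNIV (\<lambda>y. F' (x(i := y)))"
    and F_le: "\<And>x. \<bar>F x\<bar> \<le> K * (1 + (\<Sum>j\<in>I. \<bar>x j\<bar>))"
    and F'_le: "\<And>x. \<bar>F' x\<bar> \<le> K * (1 + (\<Sum>j\<in>I. \<bar>x j\<bar>))"
  shows "integrable (gauss_product I) (\<lambda>x. x i * F x)"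
    and "integrable (gauss_product I) F'"
    and "(\<integral>x. x i * F x \<partial>gauss_product I) = (\<integral>x. F' x \<partial>gauss_product I)"
proof -
  have K: "0 \<le> K"
    using F_le[of "\<lambda>_. 0"] by simp
  define L where "L x = 1 + (\<Sum>j\<in>I. \<bar>x j\<bar>)" for x :: "'a \<Rightarrow> real"
  have L: "1 \<le> L x" for x
    unfolding L_def by (simp add: sum_nonneg)
  show i1: "integrable (gauss_product I) (\<lambda>x. x i * F x)"
  proof (rule integrable_quadratic_growth[OF _ I(1)])
    fix x
    have "\<bar>x i\<bar> \<le> L x"
      unfolding L_def using member_le_sum[of i I "\<lambda>j. \<bar>x j\<bar>"] I by simp
    then have "\<bar>x i * F x\<bar> \<le> L x * (K * L x)"
      using F_le[of x] L[of x] unfolding abs_mult by (intro mult_mono) (auto simp: L_def)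
    then show "\<bar>x i * F x\<bar> \<le> K * (1 + (\<Sum>j\<in>I. \<bar>x j\<bar>))\<^sup>2"
      by (simp add: L_def power2_eq_square algebra_simps)
  qed (rule borel_measurable_times[OF measurable_gauss_product_component[OF I(2)] assms(3)])
  show i2: "integrable (gauss_product I) F'"
  proof (rule integrable_quadratic_growth[OF _ I(1)])
    fix x
    have "K * L x \<le> K * (L x)\<^sup>2"
      using L[of x] K by (intro mult_left_mono) (auto simp: power2_eq_square)
    then show "\<bar>F' x\<bar> \<le> K * (1 + (\<Sum>j\<in>I. \<bar>x j\<bar>))\<^sup>2"
      using F'_le[of x] by (simp add: L_def)
  qed (rule assms(4))
  interpret G: prob_space std_gauss by (rule prob_space_std_gauss)
  interpret P: product_sigma_finite "\<lambda>_. std_gauss" by standard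
  define J where "J = I - {i}"
  have IJ: "I = insert i J" "finite J" "i \<notin> J"
    using I by (auto simp: J_def)
  have le: "K * L (x(i := y)) \<le> K * L x * (1 + \<bar>y\<bar>)" for x y
  proof -
    have "L (x(i := y)) = 1 + \<bar>y\<bar> + (\<Sum>j\<in>J. \<bar>x j\<bar>)"
      unfolding L_def IJ(1) using IJ by (auto intro!: sum.cong)
    also have "\<dots> \<le> (1 + (\<Sum>j\<in>J. \<bar>x j\<bar>)) * (1 + \<bar>y\<bar>)"
      by (simp add: algebra_simps sum_nonneg)
    also have "\<dots> \<le> L x * (1 + \<bar>y\<bar>)"
      unfolding L_def IJ(1) using IJ by (intro mult_right_mono) auto
    finally show ?thesis using K by (simp add: mult.assoc mult_left_mono)
  qed
  have "(\<integral>x. x i * F x \<partial>gauss_product I) = (\<integral>x. (\<integral>y. y * F (x(i := y)) \<partial>std_gauss) \<partial>gauss_product J)"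
    using P.product_integral_insert[OF IJ(2,3), of "\<lambda>x. x i * F x"] i1 unfolding gauss_product_def IJ(1) by simp
  also have "\<dots> = (\<integral>x. (\<integral>y. F' (x(i := y)) \<partial>std_gauss) \<partial>gauss_product J)"
  proof -
    have "(\<integral>y. y * F (x(i := y)) \<partial>std_gauss) = (\<integral>y. F' (x(i := y)) \<partial>std_gauss)" for x
    proof (rule gaussian_integration_by_parts)
      show "\<bar>F (x(i := y))\<bar> \<le> K * L x * (1 + \<bar>y\<bar>)" "\<bar>F' (x(i := y))\<bar> \<le> K * L x * (1 + \<bar>y\<bar>)" for y
        using F_le[of "x(i := y)"] F'_le[of "x(i := y)"] le[of x y] by (auto simp: L_def)
    qed (rule deriv cont)+
    then show ?thesis by simp
  qed
  also have "\<dots> = (\<integral>x. F' x \<partial>gauss_product I)"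
    using P.product_integral_insert[OF IJ(2,3), of F'] i2 unfolding gauss_product_def IJ(1) by simp
  finally show "(\<integral>x. x i * F x \<partial>gauss_product I) = (\<integral>x. F' x \<partial>gauss_product I)" .
qed

section \<open>Functions continuously differentiable in one coordinate\<close>

text \<open>The exponent \<open>k\<close> is the degree of polynomial growth allowed to both
  function and derivative: degree 0 holds for Gibbs averages, degree 1 for a linear combination of
  couplings. Integration by parts is applied at degree 1.\<close>

definition coord_C1 :: "'i set \<Rightarrow> 'i \<Rightarrow> nat \<Rightarrow> (('i \<Rightarrow> real) \<Rightarrow> real) \<Rightarrow> (('i \<Rightarrow> real) \<Rightarrow> real) \<Rightarrow> bool" where
  "coord_C1 I i k F F' \<longleftrightarrow>
     F \<in> borel_measurable (gauss_product I) \<and> F' \<in> borel_measurable (gauss_product I) \<and>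
     (\<forall>x y. ((\<lambda>y. F (x(i := y))) has_real_derivative F' (x(i := y))) (at y)) \<and>
     (\<forall>x. continuous_on UNIV (\<lambda>y. F' (x(i := y)))) \<and>
     (\<exists>K. \<forall>x. \<bar>F x\<bar> \<le> K * (1 + (\<Sum>j\<in>I. \<bar>x j\<bar>)) ^ k \<and> \<bar>F' x\<bar> \<le> K * (1 + (\<Sum>j\<in>I. \<bar>x j\<bar>)) ^ k)"

lemma coord_C1D:
  assumes "coord_C1 I i k F F'"
  shows "F \<in> borel_measurable (gauss_product I)" "F' \<in> borel_measurable (gauss_product I)"
    and "((\<lambda>y. F (x(i := y))) has_real_derivative F' (x(i := y))) (at y)"
    and "continuous_on UNIV (\<lambda>y. F (x(i := y)))"
    and "continuous_on UNIV (\<lambda>y. F' (x(i := y)))"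
    and "\<exists>K. \<forall>x. \<bar>F x\<bar> \<le> K * (1 + (\<Sum>j\<in>I. \<bar>x j\<bar>)) ^ k \<and> \<bar>F' x\<bar> \<le> K * (1 + (\<Sum>j\<in>I. \<bar>x j\<bar>)) ^ k"
proof -
  have d: "((\<lambda>y. F (x(i := y))) has_real_derivative F' (x(i := y))) (at y)" for x y
    using assms unfolding coord_C1_def by blast
  show "continuous_on UNIV (\<lambda>y. F (x(i := y)))"
    using DERIV_isCont[OF d] by (rule continuous_at_imp_continuous_on[OF ballI])
qed (use assms in \<open>unfold coord_C1_def, blast+\<close>)

lemma coord_C1_integration_by_parts:
  assumes "finite I" "i \<in> I" "coord_C1 I i 1 F F'"
  shows "integrable (gauss_product I) (\<lambda>x. x i * F x)"
    and "integrable (gauss_product I) F'"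
    and "(\<integral>x. x i * F x \<partial>gauss_product I) = (\<integral>x. F' x \<partial>gauss_product I)"
proof -
  obtain K where K: "\<And>x. \<bar>F x\<bar> \<le> K * (1 + (\<Sum>j\<in>I. \<bar>x j\<bar>))" "\<And>x. \<bar>F' x\<bar> \<le> K * (1 + (\<Sum>j\<in>I. \<bar>x j\<bar>))"
    using coord_C1D(6)[OF assms(3)] unfolding power_one_right by blast
  note parts = gauss_product_integration_by_parts[OF assms(1,2) coord_C1D(1-3,5)[OF assms(3)] K]
  show "integrable (gauss_product I) (\<lambda>x. x i * F x)"
    and "integrable (gauss_product I) F'"
    and "(\<integral>x. x i * F x \<partial>gauss_product I) = (\<integral>x. F' x \<partial>gauss_product I)"
    by (fact parts)+
qed

lemma coord_C1_bounded_linear: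
  assumes "coord_C1 I i 0 F F'"
  shows "coord_C1 I i 1 F F'"
proof -
  obtain K where K: "\<And>x. \<bar>F x\<bar> \<le> K" "\<And>x. \<bar>F' x\<bar> \<le> K"
    using coord_C1D(6)[OF assms] unfolding power_0 mult_1_right by blast
  have K0: "0 \<le> K" using K(1) abs_ge_zero order_trans by blast
  have "K \<le> K * (1 + (\<Sum>j\<in>I. \<bar>x j\<bar>)) ^ 1" for x
    using K0 by (simp add: algebra_simps sum_nonneg)
  then have "\<exists>K. \<forall>x. \<bar>F x\<bar> \<le> K * (1 + (\<Sum>j\<in>I. \<bar>x j\<bar>)) ^ 1 \<and> \<bar>F' x\<bar> \<le> K * (1 + (\<Sum>j\<in>I. \<bar>x j\<bar>)) ^ 1"
    using K order_trans by blast
  then show ?thesis using assms unfolding coord_C1_def by blast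
qed

text \<open>Product rule; growth degrees add, so a linear factor times a bounded one stays within
  the range of the integration by parts.\<close>

lemma coord_C1_mult:
  assumes F: "coord_C1 I i k F F'" and G: "coord_C1 I i l G G'"
  shows "coord_C1 I i (k + l) (\<lambda>x. F x * G x) (\<lambda>x. F' x * G x + F x * G' x)"
proof -
  define L where "L x = 1 + (\<Sum>j\<in>I. \<bar>x j\<bar>)" for x :: "'a \<Rightarrow> real"
  have L: "0 \<le> L x" for x unfolding L_def by (simp add: sum_nonneg)
  obtain K where K: "\<And>x. \<bar>F x\<bar> \<le> K * L x ^ k" "\<And>x. \<bar>F' x\<bar> \<le> K * L x ^ k"
    using coord_C1D(6)[OF F] unfolding L_def by blast
  obtain K' where K': "\<And>x. \<bar>G x\<bar> \<le> K' * L x ^ l" "\<And>x. \<bar>G' x\<bar> \<le> K' * L x ^ l"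
    using coord_C1D(6)[OF G] unfolding L_def by blast
  have prod_le: "\<bar>p * q\<bar> \<le> (K * K') * L x ^ (k + l)"
    if "\<bar>p\<bar> \<le> K * L x ^ k" "\<bar>q\<bar> \<le> K' * L x ^ l" for p q x
    using mult_mono[OF that] order_trans[OF abs_ge_zero that(1)] by (simp add: abs_mult power_add mult_ac)
  have KK: "0 \<le> K * K' * L x ^ (k + l)" for x
    using prod_le[OF K(1) K'(1)] abs_ge_zero order_trans by blast
  \<comment> \<open>The factor 2 pays for the two terms of the product rule; the same constant then
    serves the product itself.\<close>
  have "\<bar>F x * G x\<bar> \<le> (2 * (K * K')) * L x ^ (k + l)" for x
    using prod_le[OF K(1) K'(1), of x] KK[of x] by (simp add: mult.assoc)
  moreover have "\<bar>F' x * G x + F x * G' x\<bar> \<le> (2 * (K * K')) * L x ^ (k + l)" for x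
    using prod_le[OF K(2) K'(1), of x] prod_le[OF K(1) K'(2), of x] by (simp add: mult.assoc)
  ultimately have bound: "\<exists>K. \<forall>x. \<bar>F x * G x\<bar> \<le> K * L x ^ (k + l) \<and> \<bar>F' x * G x + F x * G' x\<bar> \<le> K * L x ^ (k + l)"
    by blast
  note dF = coord_C1D(3)[OF F] and dG = coord_C1D(3)[OF G]
  have deriv: "((\<lambda>y. F (x(i := y)) * G (x(i := y))) has_real_derivative
      F' (x(i := y)) * G (x(i := y)) + F (x(i := y)) * G' (x(i := y))) (at y)" for x y
    using DERIV_mult[OF dF[of x y] dG[of x y]] by (simp add: mult.commute)
  have cont: "continuous_on UNIV (\<lambda>y. F' (x(i := y)) * G (x(i := y)) + F (x(i := y)) * G' (x(i := y)))" for x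
    by (intro continuous_on_add continuous_on_mult coord_C1D(4,5)[OF F] coord_C1D(4,5)[OF G])
  have meas: "(\<lambda>x. F x * G x) \<in> borel_measurable (gauss_product I)"
    "(\<lambda>x. F' x * G x + F x * G' x) \<in> borel_measurable (gauss_product I)"
    by (intro borel_measurable_add borel_measurable_times coord_C1D(1,2)[OF F] coord_C1D(1,2)[OF G])+
  show ?thesis
    unfolding coord_C1_def by (intro conjI allI deriv cont meas bound[unfolded L_def])
qed

subsection \<open>Rotated Gaussian families\<close>

text \<open>Measurability is only asked for along the maps \<open>u\<close> that occur below, since the values of \<open>v\<close>
  outside \<open>E\<close> are arbitrary.\<close>

definition smooth_bounded :: "'e set \<Rightarrow> (('e \<Rightarrow> real) \<Rightarrow> real) \<Rightarrow> ('e \<Rightarrow> ('e \<Rightarrow> real) \<Rightarrow> real) \<Rightarrow> bool" where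
  "smooth_bounded E F F' \<longleftrightarrow>
     (\<forall>e\<in>E. \<forall>v y. ((\<lambda>y. F (v(e := y))) has_real_derivative F' e (v(e := y))) (at y)) \<and>
     (\<forall>e\<in>E. \<forall>v. continuous_on UNIV (\<lambda>y. F' e (v(e := y)))) \<and>
     (\<exists>K. \<forall>v. \<bar>F v\<bar> \<le> K \<and> (\<forall>e\<in>E. \<bar>F' e v\<bar> \<le> K)) \<and>
     (\<forall>(N :: ('e + 'e \<Rightarrow> real) measure) u. (\<forall>e\<in>E. (\<lambda>x. u x e) \<in> borel_measurable N) \<longrightarrow>
        (\<lambda>x. F (u x)) \<in> borel_measurable N \<and> (\<forall>e\<in>E. (\<lambda>x. F' e (u x)) \<in> borel_measurable N))"

text \<open>\<open>Inl\<close> carries the original couplings and \<open>Inr\<close> the independent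
  copy. When \<open>s^2 + c^2 = 1\<close>, the families \<open>lin_comb s c\<close> and
  \<open>lin_comb c (- s)\<close> are the two rows of a rotation, hence independent standard
  Gaussian families; this is exploited below only through integration by parts.\<close>

definition lin_comb :: "real \<Rightarrow> real \<Rightarrow> ('e + 'e \<Rightarrow> real) \<Rightarrow> 'e \<Rightarrow> real" where
  "lin_comb p q x e = p * x (Inl e) + q * x (Inr e)"

text \<open>Moving one underlying Gaussian moves a single coupling, and affinely. Derivatives of
  composites thus reduce to the coordinate derivatives in \<open>smooth_bounded\<close>.\<close>

lemma lin_comb_upd:
  "lin_comb p q (x(Inl e := y)) = (lin_comb p q x)(e := p * y + q * x (Inr e))"
  "lin_comb p q (x(Inr e := y)) = (lin_comb p q x)(e := q * y + p * x (Inl e))"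
  by (auto simp: lin_comb_def fun_eq_iff)

lemma measurable_lin_comb:
  assumes "e \<in> E"
  shows "(\<lambda>x. lin_comb p q x e) \<in> borel_measurable (gauss_product (E <+> E))"
  unfolding lin_comb_def
  by (intro borel_measurable_add borel_measurable_times borel_measurable_const
      measurable_gauss_product_component InlI InrI assms)

lemma smooth_boundedD:
  assumes "smooth_bounded E F F'"
  shows "e \<in> E \<Longrightarrow> ((\<lambda>y. F (v(e := y))) has_real_derivative F' e (v(e := y))) (at y)"
    and "e \<in> E \<Longrightarrow> continuous_on UNIV (\<lambda>y. F (v(e := y)))"
    and "e \<in> E \<Longrightarrow> continuous_on UNIV (\<lambda>y. F' e (v(e := y)))"
    and "\<exists>K. \<forall>v. \<bar>F v\<bar> \<le> K \<and> (\<forall>e\<in>E. \<bar>F' e v\<bar> \<le> K)"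
proof -
  have d: "((\<lambda>y. F (v(e := y))) has_real_derivative F' e (v(e := y))) (at y)" if "e \<in> E" for v y
    using assms that unfolding smooth_bounded_def by blast
  show "continuous_on UNIV (\<lambda>y. F (v(e := y)))" if "e \<in> E"
    using DERIV_isCont[OF d[OF that]] by (rule continuous_at_imp_continuous_on[OF ballI])
qed (use assms in \<open>unfold smooth_bounded_def, blast+\<close>)

lemma smooth_bounded_measurable:
  fixes u :: "('e + 'e \<Rightarrow> real) \<Rightarrow> 'e \<Rightarrow> real"
  assumes "smooth_bounded E F F'" "\<And>e. e \<in> E \<Longrightarrow> (\<lambda>x. u x e) \<in> borel_measurable N"
  shows "(\<lambda>x. F (u x)) \<in> borel_measurable N"
    and "e \<in> E \<Longrightarrow> (\<lambda>x. F' e (u x)) \<in> borel_measurable N"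
proof -
  have "(\<lambda>x. F (u x)) \<in> borel_measurable N \<and> (\<forall>e\<in>E. (\<lambda>x. F' e (u x)) \<in> borel_measurable N)"
    using assms unfolding smooth_bounded_def by metis
  then show "(\<lambda>x. F (u x)) \<in> borel_measurable N"
    and "e \<in> E \<Longrightarrow> (\<lambda>x. F' e (u x)) \<in> borel_measurable N" by blast+
qed

lemma measurable_smooth_bounded_lin_comb:
  assumes "smooth_bounded E F F'"
  shows "(\<lambda>x. F (lin_comb p q x)) \<in> borel_measurable (gauss_product (E <+> E))"
    and "e \<in> E \<Longrightarrow> (\<lambda>x. F' e (lin_comb p q x)) \<in> borel_measurable (gauss_product (E <+> E))"
  by (rule smooth_bounded_measurable[OF assms measurable_lin_comb]; assumption)+

text \<open>Chain rule along the affine dependence in \<open>lin_comb_upd\<close>: the coefficient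
  of the moved Gaussian appears as a factor.\<close>

lemma coord_C1_smooth_bounded:
  assumes F: "smooth_bounded E F F'" and e: "e \<in> E"
  shows "coord_C1 (E <+> E) (Inl e) 0 (\<lambda>x. F (lin_comb p q x)) (\<lambda>x. p * F' e (lin_comb p q x))"
    and "coord_C1 (E <+> E) (Inr e) 0 (\<lambda>x. F (lin_comb p q x)) (\<lambda>x. q * F' e (lin_comb p q x))"
proof -
  have deriv: "((\<lambda>y. F (v(e := r * y + z))) has_real_derivative r * F' e (v(e := r * y + z))) (at y)" for v r y z
  proof -
    have "((\<lambda>y. F (v(e := y))) has_real_derivative F' e (v(e := r * y + z))) (at (r * y + z))"
      by (rule smooth_boundedD(1)[OF F e])
    then have "((\<lambda>y. F (v(e := r * y + z))) has_real_derivative F' e (v(e := r * y + z)) * r) (at y)"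
      by (rule DERIV_chain2) (auto intro!: derivative_eq_intros)
    then show ?thesis by (simp add: mult.commute)
  qed
  have cont: "continuous_on UNIV (\<lambda>y. r * F' e (v(e := r * y + z)))" for v r z
  proof -
    have "continuous_on UNIV (\<lambda>y. F' e (v(e := y)))"
      by (rule smooth_boundedD(3)[OF F e])
    then have "continuous_on UNIV (\<lambda>y. F' e (v(e := r * y + z)))"
      by (rule continuous_on_compose2) (auto intro!: continuous_intros)
    then show ?thesis by (intro continuous_intros)
  qed
  obtain K where K: "\<And>v. \<bar>F v\<bar> \<le> K" "\<And>v. \<bar>F' e v\<bar> \<le> K"
    using smooth_boundedD(4)[OF F] e by blast
  have bound: "\<exists>K. \<forall>x. \<bar>F (lin_comb p q x)\<bar> \<le> K * (1 + (\<Sum>j\<in>I. \<bar>x j\<bar>)) ^ 0 \<and>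
      \<bar>r * F' e (lin_comb p q x)\<bar> \<le> K * (1 + (\<Sum>j\<in>I. \<bar>x j\<bar>)) ^ 0" for r p q I
  proof (intro exI allI conjI)
    fix x
    show "\<bar>F (lin_comb p q x)\<bar> \<le> max K (\<bar>r\<bar> * K) * (1 + (\<Sum>j\<in>I. \<bar>x j\<bar>)) ^ 0"
      using K(1)[of "lin_comb p q x"] by simp
    show "\<bar>r * F' e (lin_comb p q x)\<bar> \<le> max K (\<bar>r\<bar> * K) * (1 + (\<Sum>j\<in>I. \<bar>x j\<bar>)) ^ 0"
      using mult_left_mono[OF K(2)[of "lin_comb p q x"], of "\<bar>r\<bar>"] by (simp add: abs_mult)
  qed
  have meas: "(\<lambda>x. F (lin_comb p q x)) \<in> borel_measurable (gauss_product (E <+> E))"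
    "(\<lambda>x. r * F' e (lin_comb p q x)) \<in> borel_measurable (gauss_product (E <+> E))" for p q r
    by (intro borel_measurable_times borel_measurable_const measurable_smooth_bounded_lin_comb[OF F] e)+
  show "coord_C1 (E <+> E) (Inl e) 0 (\<lambda>x. F (lin_comb p q x)) (\<lambda>x. p * F' e (lin_comb p q x))"
    unfolding coord_C1_def lin_comb_upd by (intro conjI allI deriv cont bound meas)
  show "coord_C1 (E <+> E) (Inr e) 0 (\<lambda>x. F (lin_comb p q x)) (\<lambda>x. q * F' e (lin_comb p q x))"
    unfolding coord_C1_def lin_comb_upd by (intro conjI allI deriv cont bound meas)
qed

text \<open>Supplies the linear factor of the second moment computation; its derivative is a
  Kronecker delta, which later makes the off-diagonal terms vanish.\<close>

lemma coord_C1_lin_comb: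
  assumes "finite E" "k \<in> E"
  shows "coord_C1 (E <+> E) (Inl e) 1 (\<lambda>x. lin_comb p q x k) (\<lambda>_. if e = k then p else 0)"
    and "coord_C1 (E <+> E) (Inr e) 1 (\<lambda>x. lin_comb p q x k) (\<lambda>_. if e = k then q else 0)"
proof -
  have bound: "\<exists>K. \<forall>x. \<bar>lin_comb p q x k\<bar> \<le> K * (1 + (\<Sum>j\<in>E <+> E. \<bar>x j\<bar>)) ^ 1 \<and>
      \<bar>if e = k then r else 0\<bar> \<le> K * (1 + (\<Sum>j\<in>E <+> E. \<bar>x j\<bar>)) ^ 1" if "r = p \<or> r = q" for r
  proof (intro exI allI conjI)
    fix x :: "'a + 'a \<Rightarrow> real"
    let ?S = "\<Sum>j\<in>E <+> E. \<bar>x j\<bar>"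
    have S0: "0 \<le> ?S" by (simp add: sum_nonneg)
    have S: "\<bar>x (Inl k)\<bar> \<le> ?S" "\<bar>x (Inr k)\<bar> \<le> ?S"
      using assms by (auto intro!: member_le_sum)
    have "\<bar>lin_comb p q x k\<bar> \<le> \<bar>p\<bar> * ?S + \<bar>q\<bar> * ?S"
      unfolding lin_comb_def using S
      by (intro order_trans[OF abs_triangle_ineq] add_mono) (auto simp: abs_mult intro: mult_left_mono)
    then show "\<bar>lin_comb p q x k\<bar> \<le> (\<bar>p\<bar> + \<bar>q\<bar>) * (1 + ?S) ^ 1"
      by (simp add: algebra_simps)
    have "\<bar>r\<bar> \<le> (\<bar>p\<bar> + \<bar>q\<bar>) * 1" using that by auto
    also have "\<dots> \<le> (\<bar>p\<bar> + \<bar>q\<bar>) * (1 + ?S)" using S0 by (intro mult_left_mono) auto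
    finally show "\<bar>if e = k then r else 0\<bar> \<le> (\<bar>p\<bar> + \<bar>q\<bar>) * (1 + ?S) ^ 1"
      using S0 by simp
  qed
  have meas: "(\<lambda>x. lin_comb p q x k) \<in> borel_measurable (gauss_product (E <+> E))"
    by (rule measurable_lin_comb[OF assms(2)])
  show "coord_C1 (E <+> E) (Inl e) 1 (\<lambda>x. lin_comb p q x k) (\<lambda>_. if e = k then p else 0)"
    unfolding coord_C1_def lin_comb_upd using bound[of p]
    by (intro conjI allI meas borel_measurable_const) (auto intro!: derivative_eq_intros)
  show "coord_C1 (E <+> E) (Inr e) 1 (\<lambda>x. lin_comb p q x k) (\<lambda>_. if e = k then q else 0)"
    unfolding coord_C1_def lin_comb_upd using bound[of q]
    by (intro conjI allI meas borel_measurable_const) (auto intro!: derivative_eq_intros)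
qed

text \<open>Serves twice: for \<open>B e * B k\<close> when a sum is squared, and for the product of
  two bond averages as the factor \<open>B\<close> in the second half of the variance.\<close>

lemma smooth_bounded_mult:
  assumes F: "smooth_bounded E F F'" and G: "smooth_bounded E G G'"
  shows "smooth_bounded E (\<lambda>v. F v * G v) (\<lambda>e v. F' e v * G v + F v * G' e v)"
proof -
  obtain K where K: "\<And>v. \<bar>F v\<bar> \<le> K" "\<And>v e. e \<in> E \<Longrightarrow> \<bar>F' e v\<bar> \<le> K"
    using smooth_boundedD(4)[OF F] by blast
  obtain L where L: "\<And>v. \<bar>G v\<bar> \<le> L" "\<And>v e. e \<in> E \<Longrightarrow> \<bar>G' e v\<bar> \<le> L"
    using smooth_boundedD(4)[OF G] by blast
  have prod_le: "\<bar>p * q\<bar> \<le> K * L" if "\<bar>p\<bar> \<le> K" "\<bar>q\<bar> \<le> L" for p q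
    using mult_mono[OF that] order_trans[OF abs_ge_zero that(1)] by (simp add: abs_mult)
  have KL: "0 \<le> K * L"
    using prod_le[OF K(1) L(1)] abs_ge_zero order_trans by blast
  have bound: "\<exists>K. \<forall>v. \<bar>F v * G v\<bar> \<le> K \<and> (\<forall>e\<in>E. \<bar>F' e v * G v + F v * G' e v\<bar> \<le> K)"
  proof (intro exI allI conjI ballI)
    show "\<bar>F v * G v\<bar> \<le> 2 * (K * L)" for v
      using prod_le[OF K(1)[of v] L(1)[of v]] KL by simp
    show "\<bar>F' e v * G v + F v * G' e v\<bar> \<le> 2 * (K * L)" if "e \<in> E" for e v
      using prod_le[OF K(2)[OF that, of v] L(1)[of v]] prod_le[OF K(1)[of v] L(2)[OF that, of v]] by simp
  qed
  note dF = smooth_boundedD(1)[OF F] and dG = smooth_boundedD(1)[OF G]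
  have deriv: "((\<lambda>y. F (v(e := y)) * G (v(e := y))) has_real_derivative
      F' e (v(e := y)) * G (v(e := y)) + F (v(e := y)) * G' e (v(e := y))) (at y)" if "e \<in> E" for e v y
    using DERIV_mult[OF dF[OF that, of v y] dG[OF that, of v y]] by (simp add: mult.commute)
  have cont: "continuous_on UNIV (\<lambda>y. F' e (v(e := y)) * G (v(e := y)) + F (v(e := y)) * G' e (v(e := y)))"
    if "e \<in> E" for v e
    by (intro continuous_on_add continuous_on_mult smooth_boundedD(2,3)[OF F that] smooth_boundedD(2,3)[OF G that])
  have meas: "(\<lambda>x. F (u x) * G (u x)) \<in> borel_measurable N"
      "\<And>e. e \<in> E \<Longrightarrow> (\<lambda>x. F' e (u x) * G (u x) + F (u x) * G' e (u x)) \<in> borel_measurable N"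
    if "\<forall>e\<in>E. (\<lambda>x. u x e) \<in> borel_measurable N" for N :: "('a + 'a \<Rightarrow> real) measure" and u
    using that by (intro borel_measurable_add borel_measurable_times
        smooth_bounded_measurable[OF F] smooth_bounded_measurable[OF G]; blast)+
  show ?thesis
    unfolding smooth_bounded_def by (intro conjI allI ballI impI deriv cont bound meas) blast+
qed

section \<open>Integration by parts along a rotated direction\<close>

text \<open>Integrating by parts separately in the \<open>Inl\<close> and \<open>Inr\<close>
  coordinates of \<open>e\<close> and adding with weights \<open>s\<close> and \<open>c\<close>
  yields the directional derivative along \<open>(s, c)\<close>.\<close>

lemma lin_comb_integration_by_parts:
  assumes "finite E" "e \<in> E"
    and "coord_C1 (E <+> E) (Inl e) 1 F F1" "coord_C1 (E <+> E) (Inr e) 1 F F2"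
  shows "integrable (gauss_product (E <+> E)) (\<lambda>x. lin_comb s c x e * F x)"
    and "(\<integral>x. lin_comb s c x e * F x \<partial>gauss_product (E <+> E)) =
         (\<integral>x. s * F1 x + c * F2 x \<partial>gauss_product (E <+> E))"
proof -
  have I: "finite (E <+> E)" "Inl e \<in> E <+> E" "Inr e \<in> E <+> E"
    using assms by auto
  note l = coord_C1_integration_by_parts[OF I(1,2) assms(3)]
  note r = coord_C1_integration_by_parts[OF I(1,3) assms(4)]
  have eq: "lin_comb s c x e * F x = s * (x (Inl e) * F x) + c * (x (Inr e) * F x)" for x
    by (simp add: lin_comb_def algebra_simps)
  show "integrable (gauss_product (E <+> E)) (\<lambda>x. lin_comb s c x e * F x)"
    unfolding eq by (intro Bochner_Integration.integrable_add integrable_mult_right l(1) r(1))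
  have "(\<integral>x. lin_comb s c x e * F x \<partial>gauss_product (E <+> E)) =
      s * (\<integral>x. x (Inl e) * F x \<partial>gauss_product (E <+> E)) + c * (\<integral>x. x (Inr e) * F x \<partial>gauss_product (E <+> E))"
    unfolding eq using l(1) r(1)
    by (subst Bochner_Integration.integral_add) (auto intro: integrable_mult_right)
  also have "\<dots> = (\<integral>x. s * F1 x + c * F2 x \<partial>gauss_product (E <+> E))"
    unfolding l(3) r(3) using l(2) r(2)
    by (subst Bochner_Integration.integral_add) (auto intro: integrable_mult_right)
  finally show "(\<integral>x. lin_comb s c x e * F x \<partial>gauss_product (E <+> E)) =
         (\<integral>x. s * F1 x + c * F2 x \<partial>gauss_product (E <+> E))" .
qed

lemma integrable_smooth_bounded:
  assumes "smooth_bounded E F F'"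
  shows "integrable (gauss_product (E <+> E)) (\<lambda>x. F (lin_comb p q x))"
    and "e \<in> E \<Longrightarrow> integrable (gauss_product (E <+> E)) (\<lambda>x. F' e (lin_comb p q x))"
proof -
  interpret prob_space "gauss_product (E <+> E)" by (rule prob_space_gauss_product)
  obtain K where K: "\<And>v. \<bar>F v\<bar> \<le> K" "\<And>v e. e \<in> E \<Longrightarrow> \<bar>F' e v\<bar> \<le> K"
    using smooth_boundedD(4)[OF assms] by blast
  show "integrable (gauss_product (E <+> E)) (\<lambda>x. F (lin_comb p q x))"
    by (rule integrable_const_bound[where B = K])
      (use K in \<open>auto intro: measurable_smooth_bounded_lin_comb(1)[OF assms]\<close>)
  show "integrable (gauss_product (E <+> E)) (\<lambda>x. F' e (lin_comb p q x))" if "e \<in> E"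
    by (rule integrable_const_bound[where B = K])
      (use that K in \<open>auto intro: measurable_smooth_bounded_lin_comb(2)[OF assms]\<close>)
qed

text \<open>The direction \<open>(s, c)\<close> of the differentiation is orthogonal to the coefficients \<open>(c, - s)\<close> of the
  argument of \<open>B\<close>, so no derivative of \<open>B\<close> appears.\<close>

lemma rotated_integration_by_parts:
  assumes "finite E" "e \<in> E" and B: "smooth_bounded E B B'" and m: "smooth_bounded E m m'"
  shows "integrable (gauss_product (E <+> E))
           (\<lambda>x. lin_comb s c x e * (B (lin_comb c (- s) x) * m (lin_comb p q x)))"
    and "(\<integral>x. lin_comb s c x e * (B (lin_comb c (- s) x) * m (lin_comb p q x)) \<partial>gauss_product (E <+> E)) =
         (s * p + c * q) * (\<integral>x. B (lin_comb c (- s) x) * m' e (lin_comb p q x) \<partial>gauss_product (E <+> E))"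
proof -
  note l = coord_C1_bounded_linear[OF coord_C1_mult[where k = 0 and l = 0, simplified,
      OF coord_C1_smooth_bounded(1)[OF B assms(2), of c "- s"] coord_C1_smooth_bounded(1)[OF m assms(2), of p q]]]
  note r = coord_C1_bounded_linear[OF coord_C1_mult[where k = 0 and l = 0, simplified,
      OF coord_C1_smooth_bounded(2)[OF B assms(2), of c "- s"] coord_C1_smooth_bounded(2)[OF m assms(2), of p q]]]
  note parts = lin_comb_integration_by_parts[OF assms(1,2) l r, of s c]
  show "integrable (gauss_product (E <+> E))
      (\<lambda>x. lin_comb s c x e * (B (lin_comb c (- s) x) * m (lin_comb p q x)))"
    by (rule parts(1))
  have "s * (c * B' e u * m v + B u * (p * m' e v)) + c * (- s * B' e u * m v + B u * (q * m' e v)) =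
      (s * p + c * q) * (B u * m' e v)" for u v
    by (simp add: algebra_simps)
  then show "(\<integral>x. lin_comb s c x e * (B (lin_comb c (- s) x) * m (lin_comb p q x)) \<partial>gauss_product (E <+> E)) =
      (s * p + c * q) * (\<integral>x. B (lin_comb c (- s) x) * m' e (lin_comb p q x) \<partial>gauss_product (E <+> E))"
    unfolding parts(2) by simp
qed

text \<open>The derivative along \<open>(s, c)\<close> does not see \<open>P\<close>, whose argument
  lies in the orthogonal direction: its two contributions \<open>s * c\<close> and
  \<open>c * (- s)\<close> cancel. Only the derivative of the second linear factor survives, giving
  the covariance of the rotated family.\<close>

lemma rotated_second_moment:
  assumes "finite E" "e \<in> E" "k \<in> E" and P: "smooth_bounded E P P'"
  shows "integrable (gauss_product (E <+> E))
           (\<lambda>x. lin_comb s c x e * (lin_comb s c x k * P (lin_comb c (- s) x)))"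
    and "(\<integral>x. lin_comb s c x e * (lin_comb s c x k * P (lin_comb c (- s) x)) \<partial>gauss_product (E <+> E)) =
         (if e = k then (s\<^sup>2 + c\<^sup>2) * (\<integral>x. P (lin_comb c (- s) x) \<partial>gauss_product (E <+> E)) else 0)"
proof -
  note l = coord_C1_mult[where k = 1 and l = 0, unfolded add_0_right,
      OF coord_C1_lin_comb(1)[OF assms(1,3), of e s c] coord_C1_smooth_bounded(1)[OF P assms(2), of c "- s"]]
  note r = coord_C1_mult[where k = 1 and l = 0, unfolded add_0_right,
      OF coord_C1_lin_comb(2)[OF assms(1,3), of e s c] coord_C1_smooth_bounded(2)[OF P assms(2), of c "- s"]]
  note parts = lin_comb_integration_by_parts[OF assms(1,2) l r, of s c]
  show "integrable (gauss_product (E <+> E))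
      (\<lambda>x. lin_comb s c x e * (lin_comb s c x k * P (lin_comb c (- s) x)))"
    by (rule parts(1))
  have "s * ((if e = k then s else 0) * P u + w * (c * P' e u)) +
        c * ((if e = k then c else 0) * P u + w * (- s * P' e u)) =
      (if e = k then s\<^sup>2 + c\<^sup>2 else 0) * P u" for u w
    by (simp add: algebra_simps power2_eq_square)
  then show "(\<integral>x. lin_comb s c x e * (lin_comb s c x k * P (lin_comb c (- s) x)) \<partial>gauss_product (E <+> E)) =
         (if e = k then (s\<^sup>2 + c\<^sup>2) * (\<integral>x. P (lin_comb c (- s) x) \<partial>gauss_product (E <+> E)) else 0)"
    unfolding parts(2) by simp
qed

text \<open>Integration by parts turns the sum into \<open>E (m W)\<close> with \<open>W = (\<Sum>e\<in>E. w e * B e u)\<close>, and a second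
  integration by parts gives \<open>E (W\<^sup>2) = (\<Sum>e\<in>E. E ((B e u)\<^sup>2)) \<le> card E\<close>.\<close>

lemma abs_sum_derivative_le:
  assumes E: "finite E" "E \<noteq> {}" and sc: "s\<^sup>2 + c\<^sup>2 = 1"
    and B: "\<And>e. e \<in> E \<Longrightarrow> smooth_bounded E (B e) (B' e)" and B_le: "\<And>e v. e \<in> E \<Longrightarrow> \<bar>B e v\<bar> \<le> 1"
    and m: "smooth_bounded E m m'" and m_le: "\<And>v. \<bar>m v\<bar> \<le> 1"
  shows "\<bar>s * p + c * q\<bar> * \<bar>\<Sum>e\<in>E. \<integral>x. B e (lin_comb c (- s) x) * m' e (lin_comb p q x) \<partial>gauss_product (E <+> E)\<bar>
           \<le> sqrt (card E)"
proof -
  interpret prob_space "gauss_product (E <+> E)" by (rule prob_space_gauss_product)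
  define r where "r = sqrt (card E)"
  have r: "0 < r" "r\<^sup>2 = card E"
    using E by (auto simp: r_def card_gt_0_iff)
  define W where "W x = (\<Sum>e\<in>E. lin_comb s c x e * B e (lin_comb c (- s) x))" for x
  let ?W2 = "\<lambda>e k x. lin_comb s c x e * (lin_comb s c x k * (B e (lin_comb c (- s) x) * B k (lin_comb c (- s) x)))"
  have W2: "(W x)\<^sup>2 = (\<Sum>e\<in>E. \<Sum>k\<in>E. ?W2 e k x)" for x
    unfolding W_def power2_eq_square sum_product by (intro sum.cong refl) (simp add: mult_ac)
  have i2: "integrable (gauss_product (E <+> E)) (?W2 e k)" if "e \<in> E" "k \<in> E" for e k
    by (rule rotated_second_moment(1)[OF E(1) that smooth_bounded_mult[OF B B], OF that])
  have iW2: "integrable (gauss_product (E <+> E)) (\<lambda>x. (W x)\<^sup>2)"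
    unfolding W2 by (intro Bochner_Integration.integrable_sum i2)
  have "expectation (\<lambda>x. (W x)\<^sup>2) = (\<Sum>e\<in>E. \<Sum>k\<in>E. expectation (?W2 e k))"
    unfolding W2 by (simp add: i2)
  \<comment> \<open>Only the diagonal remains, with weight \<open>s^2 + c^2 = 1\<close>, so the
    double sum contributes at most one per edge.\<close>
  also have "\<dots> = (\<Sum>e\<in>E. \<Sum>k\<in>E. if e = k then expectation (\<lambda>x. B e (lin_comb c (- s) x) * B k (lin_comb c (- s) x)) else 0)"
    by (intro sum.cong refl) (simp add: rotated_second_moment(2)[OF E(1) _ _ smooth_bounded_mult[OF B B]] sc)
  also have "\<dots> = (\<Sum>e\<in>E. expectation (\<lambda>x. B e (lin_comb c (- s) x) * B e (lin_comb c (- s) x)))"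
    using E by simp
  also have "\<dots> \<le> (\<Sum>e\<in>E. 1)"
  proof (intro sum_mono integral_le_const AE_I2)
    fix e x assume e: "e \<in> E"
    show "integrable (gauss_product (E <+> E)) (\<lambda>x. B e (lin_comb c (- s) x) * B e (lin_comb c (- s) x))"
      by (rule integrable_smooth_bounded(1)[OF smooth_bounded_mult[OF B B], OF e e])
    show "B e (lin_comb c (- s) x) * B e (lin_comb c (- s) x) \<le> 1"
      using B_le[OF e, of "lin_comb c (- s) x"] abs_square_le_1[of "B e (lin_comb c (- s) x)"]
      by (simp add: power2_eq_square)
  qed
  finally have EW2: "expectation (\<lambda>x. (W x)\<^sup>2) \<le> r\<^sup>2"
    by (simp add: r)
  let ?mW = "\<lambda>e x. lin_comb s c x e * (B e (lin_comb c (- s) x) * m (lin_comb p q x))"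
  have mW: "m (lin_comb p q x) * W x = (\<Sum>e\<in>E. ?mW e x)" for x
    unfolding W_def sum_distrib_left by (intro sum.cong refl) (simp add: mult_ac)
  have imW: "integrable (gauss_product (E <+> E)) (\<lambda>x. m (lin_comb p q x) * W x)"
    unfolding mW by (intro Bochner_Integration.integrable_sum rotated_integration_by_parts(1)[OF E(1) _ B m])
  have "(s * p + c * q) * (\<Sum>e\<in>E. expectation (\<lambda>x. B e (lin_comb c (- s) x) * m' e (lin_comb p q x)))
      = expectation (\<lambda>x. m (lin_comb p q x) * W x)"
    unfolding mW sum_distrib_left
    by (simp add: rotated_integration_by_parts[OF E(1) _ B m])
  \<comment> \<open>The elementary inequality \<open>2 * |W| * r <= W^2 + r^2\<close> stands in for
    Cauchy-Schwarz. The choice \<open>r = sqrt (card E)\<close> is optimal for the bound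
    \<open>r^2\<close> on the second moment of \<open>W\<close>, and the average becomes exactly
    \<open>r\<close>.\<close>
  moreover have "\<bar>expectation (\<lambda>x. m (lin_comb p q x) * W x)\<bar> \<le> expectation (\<lambda>x. ((W x)\<^sup>2 / r + r) / 2)"
  proof (rule order_trans[OF integral_abs_bound], rule integral_mono)
    show "integrable (gauss_product (E <+> E)) (\<lambda>x. \<bar>m (lin_comb p q x) * W x\<bar>)"
      using imW by simp
    show "integrable (gauss_product (E <+> E)) (\<lambda>x. ((W x)\<^sup>2 / r + r) / 2)"
      using iW2 by simp
    fix x
    have "\<bar>m (lin_comb p q x) * W x\<bar> \<le> 1 * \<bar>W x\<bar>"
      unfolding abs_mult using m_le by (intro mult_right_mono) auto
    moreover have "2 * (\<bar>W x\<bar> * r) \<le> (W x)\<^sup>2 + r\<^sup>2"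
      using sum_squares_bound[of "\<bar>W x\<bar>" r] by simp
    then have "\<bar>W x\<bar> \<le> ((W x)\<^sup>2 / r + r) / 2"
      using r(1) by (simp add: field_simps power2_eq_square)
    ultimately show "\<bar>m (lin_comb p q x) * W x\<bar> \<le> ((W x)\<^sup>2 / r + r) / 2" by simp
  qed
  moreover have "expectation (\<lambda>x. ((W x)\<^sup>2 / r + r) / 2) = (expectation (\<lambda>x. (W x)\<^sup>2) / r + r) / 2"
    using iW2 by (simp add: prob_space)
  moreover have "(expectation (\<lambda>x. (W x)\<^sup>2) / r + r) / 2 \<le> r"
    using EW2 r(1) by (simp add: field_simps power2_eq_square)
  ultimately show ?thesis
    unfolding r_def[symmetric] abs_mult[symmetric] by linarith
qed

subsection \<open>Gibbs averages\<close>

text \<open>Written as an explicit quotient of finite sums so that it can be differentiated in the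
  couplings; \<open>gibbs_avg_eq_sum\<close> links it to the probability mass function
  \<open>gibbs\<close>.\<close>

definition gibbs_avg ::
    "'v set \<Rightarrow> 'v set set \<Rightarrow> real \<Rightarrow> ('v set \<Rightarrow> real) \<Rightarrow> (('v \<Rightarrow> real) \<Rightarrow> real) \<Rightarrow> real" where
  "gibbs_avg V E \<beta> v f =
     (\<Sum>\<sigma>\<in>spin_configs V. f \<sigma> * exp (- \<beta> * ea_hamiltonian E v \<sigma>)) / partition_function V E \<beta> v"

lemma finite_graph_finite_edges:
  assumes "finite_graph V E"
  shows "finite E"
proof -
  have "E \<subseteq> Pow V" "finite V" using assms by (auto simp: finite_graph_def)
  then show ?thesis using finite_subset by blast
qed

lemma abs_bond:
  assumes "\<sigma> \<in> spin_configs V" "e \<subseteq> V"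
  shows "\<bar>bond \<sigma> e\<bar> = 1"
proof -
  have "\<bar>\<sigma> v\<bar> = 1" if "v \<in> e" for v
    using assms that PiE_mem[of \<sigma> V "\<lambda>_. {-1, 1}" v] unfolding spin_configs_def by fastforce
  then show ?thesis by (simp add: bond_def abs_prod)
qed

text \<open>Allows couplings to be exchanged for a family known to agree with them only on the
  edges, as happens after restriction to a product space.\<close>

lemma gibbs_avg_cong:
  assumes "\<And>e. e \<in> E \<Longrightarrow> v e = w e"
  shows "gibbs_avg V E \<beta> v f = gibbs_avg V E \<beta> w f"
proof -
  have "ea_hamiltonian E v = ea_hamiltonian E w"
    using assms by (simp add: ea_hamiltonian_def fun_eq_iff)
  then show ?thesis by (simp add: gibbs_avg_def partition_function_def)
qed

lemma abs_gibbs_avg_le: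
  assumes "finite V" and f: "\<And>\<sigma>. \<sigma> \<in> spin_configs V \<Longrightarrow> \<bar>f \<sigma>\<bar> \<le> K"
  shows "\<bar>gibbs_avg V E \<beta> v f\<bar> \<le> K"
proof -
  let ?w = "\<lambda>\<sigma>. exp (- \<beta> * ea_hamiltonian E v \<sigma>)"
  have Z: "0 < partition_function V E \<beta> v" using assms(1) by (rule partition_function_pos)
  have "\<bar>\<Sum>\<sigma>\<in>spin_configs V. f \<sigma> * ?w \<sigma>\<bar> \<le> (\<Sum>\<sigma>\<in>spin_configs V. K * ?w \<sigma>)"
    using f by (intro order_trans[OF sum_abs] sum_mono) (auto simp: abs_mult)
  also have "\<dots> = K * partition_function V E \<beta> v"
    by (simp add: partition_function_def sum_distrib_left)
  finally show ?thesis
    using Z by (simp add: gibbs_avg_def divide_le_eq)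
qed

lemma borel_measurable_gibbs_avg:
  assumes "\<And>e. e \<in> E \<Longrightarrow> (\<lambda>x. u x e) \<in> borel_measurable N"
  shows "(\<lambda>x. gibbs_avg V E \<beta> (u x) f) \<in> borel_measurable N"
  unfolding gibbs_avg_def partition_function_def ea_hamiltonian_def
  by (intro borel_measurable_divide borel_measurable_sum borel_measurable_times borel_measurable_const
      borel_measurable_uminus measurable_compose[OF _ borel_measurable_exp] assms)

text \<open>Each Boltzmann weight is the exponential of an affine function of the coupling, so the
  quotient rule gives \<open>\<beta>\<close> times the Gibbs covariance of \<open>f\<close> and the
  bond.\<close>

lemma gibbs_avg_derivative:
  assumes "finite V" "finite E" "e \<in> E"
  shows "((\<lambda>y. gibbs_avg V E \<beta> (v(e := y)) f) has_real_derivative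
      \<beta> * (gibbs_avg V E \<beta> (v(e := y)) (\<lambda>\<sigma>. f \<sigma> * bond \<sigma> e)
        - gibbs_avg V E \<beta> (v(e := y)) f * gibbs_avg V E \<beta> (v(e := y)) (\<lambda>\<sigma>. bond \<sigma> e))) (at y)"
proof -
  let ?S = "spin_configs V"
  define w where "w y \<sigma> = exp (- \<beta> * ea_hamiltonian E (v(e := y)) \<sigma>)" for y \<sigma>
  have H: "ea_hamiltonian E (v(e := y)) \<sigma> = - (y * bond \<sigma> e) - (\<Sum>e'\<in>E - {e}. v e' * bond \<sigma> e')" for y \<sigma>
  proof -
    have "(\<Sum>e'\<in>E. (v(e := y)) e' * bond \<sigma> e')
        = y * bond \<sigma> e + (\<Sum>e'\<in>E - {e}. (v(e := y)) e' * bond \<sigma> e')"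
      using assms by (subst sum.remove[of E e]) auto
    also have "(\<Sum>e'\<in>E - {e}. (v(e := y)) e' * bond \<sigma> e') = (\<Sum>e'\<in>E - {e}. v e' * bond \<sigma> e')"
      by (intro sum.cong) auto
    finally show ?thesis by (simp add: ea_hamiltonian_def)
  qed
  have dw: "((\<lambda>y. w y \<sigma>) has_real_derivative \<beta> * bond \<sigma> e * w y \<sigma>) (at y)" for y \<sigma>
    unfolding w_def H by (auto intro!: derivative_eq_intros)
  have d: "((\<lambda>y. \<Sum>\<sigma>\<in>?S. h \<sigma> * w y \<sigma>) has_real_derivative \<beta> * (\<Sum>\<sigma>\<in>?S. h \<sigma> * bond \<sigma> e * w y \<sigma>)) (at y)" for h y
    unfolding sum_distrib_left
    by (intro DERIV_sum) (auto intro!: derivative_eq_intros dw)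
  \<comment> \<open>The factor \<open>1\<close> puts the partition function in the shape of a
    numerator, so that \<open>d\<close> differentiates both parts of the quotient.\<close>
  have Z: "(\<Sum>\<sigma>\<in>?S. 1 * w y \<sigma>) \<noteq> 0" for y
    using partition_function_pos[OF assms(1), of E \<beta> "v(e := y)"] by (simp add: partition_function_def w_def)
  have avg: "gibbs_avg V E \<beta> (v(e := y)) h = (\<Sum>\<sigma>\<in>?S. h \<sigma> * w y \<sigma>) / (\<Sum>\<sigma>\<in>?S. 1 * w y \<sigma>)" for y h
    by (simp add: gibbs_avg_def partition_function_def w_def)
  have "(n' * z - n * z') / (z * z) = n' / z - n / z * (z' / z)" if "z \<noteq> 0" for n n' z z' :: real
    using that by (simp add: field_simps)
  from this[OF Z] show ?thesis
    unfolding avg using DERIV_divide[OF d[of f y] d[of "\<lambda>_. 1" y] Z]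
    by (simp add: right_diff_distrib mult.left_commute)
qed

lemma smooth_bounded_gibbs_avg:
  assumes "finite V" "finite E" and edges: "\<And>e. e \<in> E \<Longrightarrow> e \<subseteq> V"
  shows "smooth_bounded E (\<lambda>v. gibbs_avg V E \<beta> v f)
     (\<lambda>e v. \<beta> * (gibbs_avg V E \<beta> v (\<lambda>\<sigma>. f \<sigma> * bond \<sigma> e) - gibbs_avg V E \<beta> v f * gibbs_avg V E \<beta> v (\<lambda>\<sigma>. bond \<sigma> e)))"
proof -
  have "\<exists>K. \<forall>\<sigma>\<in>spin_configs V. \<bar>f \<sigma>\<bar> \<le> K"
    using finite_spin_configs[OF assms(1)]
    by (intro exI[of _ "\<Sum>\<sigma>\<in>spin_configs V. \<bar>f \<sigma>\<bar>"]) (auto intro: member_le_sum)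
  then obtain K where K: "\<And>\<sigma>. \<sigma> \<in> spin_configs V \<Longrightarrow> \<bar>f \<sigma>\<bar> \<le> K" by blast
  have K0: "0 \<le> K"
    using K spin_configs_nonempty[of V] by (metis abs_ge_zero all_not_in_conv order_trans)
  have f_le: "\<bar>gibbs_avg V E \<beta> v f\<bar> \<le> K" for v
    by (rule abs_gibbs_avg_le[OF assms(1) K])
  have b_le: "\<bar>gibbs_avg V E \<beta> v (\<lambda>\<sigma>. bond \<sigma> e)\<bar> \<le> 1" if "e \<in> E" for v e
    by (rule abs_gibbs_avg_le[OF assms(1)]) (simp add: abs_bond[OF _ edges[OF that]])
  have fb_le: "\<bar>gibbs_avg V E \<beta> v (\<lambda>\<sigma>. f \<sigma> * bond \<sigma> e)\<bar> \<le> K" if "e \<in> E" for v e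
    by (rule abs_gibbs_avg_le[OF assms(1)]) (simp add: abs_mult abs_bond[OF _ edges[OF that]] K)
  have bound: "\<exists>K. \<forall>v. \<bar>gibbs_avg V E \<beta> v f\<bar> \<le> K \<and>
     (\<forall>e\<in>E. \<bar>\<beta> * (gibbs_avg V E \<beta> v (\<lambda>\<sigma>. f \<sigma> * bond \<sigma> e) - gibbs_avg V E \<beta> v f * gibbs_avg V E \<beta> v (\<lambda>\<sigma>. bond \<sigma> e))\<bar> \<le> K)"
  proof (intro exI allI conjI ballI)
    show "\<bar>gibbs_avg V E \<beta> v f\<bar> \<le> max K (\<bar>\<beta>\<bar> * (K + K))" for v
      using f_le[of v] by simp
    fix v e assume e: "e \<in> E"
    have "\<bar>gibbs_avg V E \<beta> v f * gibbs_avg V E \<beta> v (\<lambda>\<sigma>. bond \<sigma> e)\<bar> \<le> K * 1"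
      unfolding abs_mult using f_le b_le[OF e] K0 by (intro mult_mono) auto
    then have "\<bar>gibbs_avg V E \<beta> v (\<lambda>\<sigma>. f \<sigma> * bond \<sigma> e) - gibbs_avg V E \<beta> v f * gibbs_avg V E \<beta> v (\<lambda>\<sigma>. bond \<sigma> e)\<bar> \<le> K + K"
      using fb_le[OF e, of v] by linarith
    then have "\<bar>\<beta>\<bar> * \<bar>gibbs_avg V E \<beta> v (\<lambda>\<sigma>. f \<sigma> * bond \<sigma> e) - gibbs_avg V E \<beta> v f * gibbs_avg V E \<beta> v (\<lambda>\<sigma>. bond \<sigma> e)\<bar> \<le> \<bar>\<beta>\<bar> * (K + K)"
      by (rule mult_left_mono) simp
    then show "\<bar>\<beta> * (gibbs_avg V E \<beta> v (\<lambda>\<sigma>. f \<sigma> * bond \<sigma> e) - gibbs_avg V E \<beta> v f * gibbs_avg V E \<beta> v (\<lambda>\<sigma>. bond \<sigma> e))\<bar>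
       \<le> max K (\<bar>\<beta>\<bar> * (K + K))"
      by (simp add: abs_mult)
  qed
  \<comment> \<open>The derivative is again a polynomial in Gibbs averages, each differentiable and
    hence continuous in the coupling.\<close>
  have c: "continuous_on UNIV (\<lambda>y. gibbs_avg V E \<beta> (v(e := y)) h)" if "e \<in> E" for e v h
    using DERIV_isCont[OF gibbs_avg_derivative[OF assms(1,2) that]]
    by (rule continuous_at_imp_continuous_on[OF ballI])
  have cont: "continuous_on UNIV (\<lambda>y. \<beta> * (gibbs_avg V E \<beta> (v(e := y)) (\<lambda>\<sigma>. f \<sigma> * bond \<sigma> e)
      - gibbs_avg V E \<beta> (v(e := y)) f * gibbs_avg V E \<beta> (v(e := y)) (\<lambda>\<sigma>. bond \<sigma> e)))" if "e \<in> E" for e v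
    by (intro continuous_on_mult continuous_on_diff continuous_on_const c[OF that])
  show ?thesis
    unfolding smooth_bounded_def
    by (intro conjI allI ballI impI gibbs_avg_derivative[OF assms(1,2)] cont bound
        borel_measurable_times borel_measurable_diff borel_measurable_const borel_measurable_gibbs_avg) blast+
qed

section \<open>Quenched averages and the variance of the overlap\<close>

lemma gibbs_avg_eq_sum:
  assumes "finite V"
  shows "gibbs_avg V E \<beta> v f = (\<Sum>\<sigma>\<in>spin_configs V. f \<sigma> * pmf (gibbs V E \<beta> v) \<sigma>)"
  by (simp add: gibbs_avg_def pmf_gibbs[OF assms] sum_divide_distrib)

lemma set_pmf_gibbs_subset:
  assumes "finite V"
  shows "set_pmf (gibbs V E \<beta> v) \<subseteq> spin_configs V"
  using pmf_gibbs[OF assms, of E \<beta> v] by (auto simp: set_pmf_eq split: if_splits)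

lemma quenched_avg_eq_sum:
  assumes "finite V"
  shows "quenched_avg V E \<beta> t g g' f = (\<Sum>\<sigma>1\<in>spin_configs V. \<Sum>\<sigma>2\<in>spin_configs V.
      f \<sigma>1 \<sigma>2 * (pmf (gibbs V E \<beta> g) \<sigma>1 * pmf (gibbs V E \<beta> (perturb t g g')) \<sigma>2))"
proof -
  have "quenched_avg V E \<beta> t g g' f = (\<Sum>z\<in>spin_configs V \<times> spin_configs V.
      pmf (pair_pmf (gibbs V E \<beta> g) (gibbs V E \<beta> (perturb t g g'))) z *\<^sub>R (case z of (\<sigma>1, \<sigma>2) \<Rightarrow> f \<sigma>1 \<sigma>2))"
    unfolding quenched_avg_def
    using assms set_pmf_gibbs_subset[OF assms] by (intro integral_measure_pmf) (auto simp: finite_spin_configs)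
  also have "\<dots> = (\<Sum>(\<sigma>1, \<sigma>2)\<in>spin_configs V \<times> spin_configs V.
      f \<sigma>1 \<sigma>2 * (pmf (gibbs V E \<beta> g) \<sigma>1 * pmf (gibbs V E \<beta> (perturb t g g')) \<sigma>2))"
    by (intro sum.cong) (auto simp: pmf_pair)
  finally show ?thesis
    by (simp add: sum.cartesian_product)
qed

text \<open>Given the couplings, the two spin configurations are independent, so averages of
  products factorize.\<close>

lemma quenched_avg_mult:
  assumes "finite V"
  shows "quenched_avg V E \<beta> t g g' (\<lambda>\<sigma>1 \<sigma>2. f \<sigma>1 * h \<sigma>2)
    = gibbs_avg V E \<beta> g f * gibbs_avg V E \<beta> (perturb t g g') h"
  unfolding quenched_avg_eq_sum[OF assms] gibbs_avg_eq_sum[OF assms] sum_product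
  by (intro sum.cong refl) (simp add: mult_ac)

lemma quenched_avg_sum:
  assumes "finite V"
  shows "quenched_avg V E \<beta> t g g' (\<lambda>\<sigma>1 \<sigma>2. \<Sum>i\<in>I. F i \<sigma>1 \<sigma>2) = (\<Sum>i\<in>I. quenched_avg V E \<beta> t g g' (F i))"
  unfolding quenched_avg_eq_sum[OF assms] sum_distrib_right
  by (simp only: sum.swap[where A = "spin_configs V" and B = I])

lemma quenched_avg_divide:
  assumes "finite V"
  shows "quenched_avg V E \<beta> t g g' (\<lambda>\<sigma>1 \<sigma>2. f \<sigma>1 \<sigma>2 / r) = quenched_avg V E \<beta> t g g' f / r"
  unfolding quenched_avg_eq_sum[OF assms] sum_divide_distrib by simp

lemma quenched_variance:
  assumes "finite V"
  shows "quenched_avg V E \<beta> t g g' (\<lambda>\<sigma>1 \<sigma>2. (f \<sigma>1 \<sigma>2 - quenched_avg V E \<beta> t g g' f)\<^sup>2)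
    = quenched_avg V E \<beta> t g g' (\<lambda>\<sigma>1 \<sigma>2. (f \<sigma>1 \<sigma>2)\<^sup>2) - (quenched_avg V E \<beta> t g g' f)\<^sup>2"
proof -
  let ?p = "pair_pmf (gibbs V E \<beta> g) (gibbs V E \<beta> (perturb t g g'))"
  have "finite (set_pmf ?p)"
    using finite_subset[OF set_pmf_gibbs_subset[OF assms] finite_spin_configs[OF assms]] by simp
  then have "measure_pmf.variance ?p (case_prod f)
      = measure_pmf.expectation ?p (\<lambda>z. (case_prod f z)\<^sup>2) - (measure_pmf.expectation ?p (case_prod f))\<^sup>2"
    by (intro measure_pmf.variance_eq integrable_measure_pmf_finite)
  then show ?thesis
    unfolding quenched_avg_def by (simp add: case_prod_unfold)
qed

text \<open>Rests on the splitting \<open>x * y - p * q = y * (x - p) + p * (y - q)\<close> with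
  \<open>x\<close>, \<open>y\<close> the two-bond averages and \<open>p\<close>, \<open>q\<close>
  the products of one-bond averages. Each summand is a truncated correlation at one set of couplings
  times a factor depending only on the other set.\<close>

lemma quenched_variance_bond_overlap:
  fixes V :: "'v set" and E :: "'v set set" and \<beta> t :: real and g g' :: "'v set \<Rightarrow> real"
  defines "m \<equiv> \<lambda>v e. gibbs_avg V E \<beta> v (\<lambda>\<sigma>. bond \<sigma> e)"
    and "A \<equiv> \<lambda>v e f. gibbs_avg V E \<beta> v (\<lambda>\<sigma>. bond \<sigma> f * bond \<sigma> e)"
    and "h \<equiv> perturb t g g'"
  assumes "finite V"
  shows "quenched_avg V E \<beta> t g g' (\<lambda>\<sigma>1 \<sigma>2. (bond_overlap E \<sigma>1 \<sigma>2
           - quenched_avg V E \<beta> t g g' (bond_overlap E))\<^sup>2)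
    = (\<Sum>f\<in>E. (\<Sum>e\<in>E. A h e f * (A g e f - m g f * m g e)) + (\<Sum>e\<in>E. (m g f * m g e) * (A h e f - m h f * m h e)))
      / (real (card E))\<^sup>2"
proof -
  have Q: "quenched_avg V E \<beta> t g g' (bond_overlap E) = (\<Sum>e\<in>E. m g e * m h e) / card E"
    unfolding bond_overlap_def m_def h_def
    by (simp only: quenched_avg_divide[OF assms(4)] quenched_avg_sum[OF assms(4)] quenched_avg_mult[OF assms(4)])
  have sq: "(bond_overlap E \<sigma>1 \<sigma>2)\<^sup>2
    = (\<Sum>f\<in>E. \<Sum>e\<in>E. (bond \<sigma>1 f * bond \<sigma>1 e) * (bond \<sigma>2 f * bond \<sigma>2 e)) / (real (card E))\<^sup>2" for \<sigma>1 \<sigma>2 :: "'v \<Rightarrow> real"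
    unfolding bond_overlap_def power_divide power2_eq_square[of "sum _ _"] sum_product
    by (simp add: mult_ac)
  have Q2: "quenched_avg V E \<beta> t g g' (\<lambda>\<sigma>1 \<sigma>2. (bond_overlap E \<sigma>1 \<sigma>2)\<^sup>2)
    = (\<Sum>f\<in>E. \<Sum>e\<in>E. A g e f * A h e f) / (real (card E))\<^sup>2"
    unfolding sq A_def h_def
    by (simp only: quenched_avg_divide[OF assms(4)] quenched_avg_sum[OF assms(4)] quenched_avg_mult[OF assms(4)])
  show ?thesis
    unfolding quenched_variance[OF assms(4)] unfolding Q Q2 power_divide power2_eq_square[of "sum _ _"] sum_product
      diff_divide_distrib[symmetric] sum_subtractf[symmetric] sum.distrib[symmetric]
    by (intro arg_cong2[where f = "(/)"] sum.cong refl) (simp add: algebra_simps)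
qed

section \<open>Law of the couplings and the decorrelation bound\<close>

text \<open>Independence over the disjoint sum says that the joint law is the product of the
  marginals. Expectations over \<open>M\<close> can then be computed under
  \<open>gauss_product\<close>.\<close>

lemma iid_gaussian_pair_distr:
  assumes "prob_space M" "iid_gaussian_pair M I g g'" "I \<noteq> {}"
  shows "(\<lambda>\<omega>. \<lambda>i\<in>I <+> I. case_sum g g' i \<omega>) \<in> measurable M (PiM (I <+> I) (\<lambda>_. borel))"
    and "distr M (PiM (I <+> I) (\<lambda>_. borel)) (\<lambda>\<omega>. \<lambda>i\<in>I <+> I. case_sum g g' i \<omega>) = gauss_product (I <+> I)"
proof -
  interpret prob_space M by fact
  have d: "distributed M lborel (case_sum g g' i) (\<lambda>x. ennreal (std_normal_density x))" if "i \<in> I <+> I" for i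
    using assms(2) that unfolding iid_gaussian_pair_def by auto
  have rv: "random_variable borel (case_sum g g' i)" if "i \<in> I <+> I" for i
    using distributed_measurable[OF d[OF that]] by simp
  show "(\<lambda>\<omega>. \<lambda>i\<in>I <+> I. case_sum g g' i \<omega>) \<in> measurable M (PiM (I <+> I) (\<lambda>_. borel))"
    by (intro measurable_restrict rv)
  have "distr M (PiM (I <+> I) (\<lambda>_. borel)) (\<lambda>\<omega>. \<lambda>i\<in>I <+> I. case_sum g g' i \<omega>)
      = PiM (I <+> I) (\<lambda>i. distr M borel (case_sum g g' i))"
    using assms(2,3) rv unfolding iid_gaussian_pair_def
    by (subst indep_vars_iff_distr_eq_PiM'[symmetric]) auto
  also have "\<dots> = gauss_product (I <+> I)"
    unfolding gauss_product_def
  proof (intro PiM_cong refl)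
    fix i assume "i \<in> I <+> I"
    have "distr M borel (case_sum g g' i) = distr M lborel (case_sum g g' i)"
      by (intro distr_cong) auto
    also have "\<dots> = std_gauss"
      using distributed_distr_eq_density[OF d[OF \<open>i \<in> I <+> I\<close>]] by simp
    finally show "distr M borel (case_sum g g' i) = std_gauss" .
  qed
  finally show "distr M (PiM (I <+> I) (\<lambda>_. borel)) (\<lambda>\<omega>. \<lambda>i\<in>I <+> I. case_sum g g' i \<omega>) = gauss_product (I <+> I)" .
qed

text \<open>The case of \<open>abs_sum_derivative_le\<close> where \<open>m\<close> is the Gibbs
  average of the bond \<open>f\<close>: its derivative in the coupling at \<open>e\<close> is
  \<open>\<beta>\<close> times the truncated correlation of \<open>e\<close> and
  \<open>f\<close>.\<close>

lemma gibbs_decorrelation: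
  fixes V :: "'v set" and E :: "'v set set" and \<beta> :: real and f :: "'v set"
  defines "m \<equiv> \<lambda>v e. gibbs_avg V E \<beta> v (\<lambda>\<sigma>. bond \<sigma> e)"
    and "A \<equiv> \<lambda>v e. gibbs_avg V E \<beta> v (\<lambda>\<sigma>. bond \<sigma> f * bond \<sigma> e)"
  assumes "finite V" "finite E" and edges: "\<And>e. e \<in> E \<Longrightarrow> e \<subseteq> V" and f: "f \<in> E"
    and sc: "s\<^sup>2 + c\<^sup>2 = 1" and \<beta>: "\<beta> > 0"
    and B: "\<And>e. e \<in> E \<Longrightarrow> smooth_bounded E (B e) (B' e)" and B_le: "\<And>e v. e \<in> E \<Longrightarrow> \<bar>B e v\<bar> \<le> 1"
  shows "\<And>e. e \<in> E \<Longrightarrow> integrable (gauss_product (E <+> E))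
      (\<lambda>x. B e (lin_comb c (- s) x) * (A (lin_comb p q x) e - m (lin_comb p q x) f * m (lin_comb p q x) e))"
    and "\<beta> * \<bar>s * p + c * q\<bar> * (\<Sum>e\<in>E. \<integral>x. B e (lin_comb c (- s) x)
      * (A (lin_comb p q x) e - m (lin_comb p q x) f * m (lin_comb p q x) e) \<partial>gauss_product (E <+> E)) \<le> sqrt (card E)"
proof -
  have m: "smooth_bounded E (\<lambda>v. m v f) (\<lambda>e v. \<beta> * (A v e - m v f * m v e))"
    unfolding m_def A_def by (rule smooth_bounded_gibbs_avg[OF assms(3,4) edges])
  have m_le: "\<bar>m v f\<bar> \<le> 1" for v
    unfolding m_def by (rule abs_gibbs_avg_le[OF assms(3)]) (simp add: abs_bond[OF _ edges[OF f]])
  have "integrable (gauss_product (E <+> E)) (\<lambda>x. B e (lin_comb c (- s) x)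
      * (\<beta> * (A (lin_comb p q x) e - m (lin_comb p q x) f * m (lin_comb p q x) e)))" if e: "e \<in> E" for e
  \<comment> \<open>As \<open>B e\<close> is bounded by one, the derivative of the average at
    \<open>f\<close> dominates the product.\<close>
  proof (rule Bochner_Integration.integrable_bound[OF integrable_smooth_bounded(2)[where p = p and q = q, OF m e]])
    show "(\<lambda>x. B e (lin_comb c (- s) x)
      * (\<beta> * (A (lin_comb p q x) e - m (lin_comb p q x) f * m (lin_comb p q x) e))) \<in> borel_measurable (gauss_product (E <+> E))"
      by (rule borel_measurable_times[OF measurable_smooth_bounded_lin_comb(1)[OF B[OF e]]
          measurable_smooth_bounded_lin_comb(2)[OF m e]])
  qed (use B_le[OF e] in \<open>auto simp: abs_mult intro!: mult_left_le_one_le\<close>)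
  then show "integrable (gauss_product (E <+> E))
      (\<lambda>x. B e (lin_comb c (- s) x) * (A (lin_comb p q x) e - m (lin_comb p q x) f * m (lin_comb p q x) e))" if "e \<in> E" for e
    using \<beta> that by (simp add: mult.left_commute[of _ \<beta>])
  have ne: "E \<noteq> {}" using f by auto
  let ?S = "\<Sum>e\<in>E. \<integral>x. B e (lin_comb c (- s) x)
      * (A (lin_comb p q x) e - m (lin_comb p q x) f * m (lin_comb p q x) e) \<partial>gauss_product (E <+> E)"
  have "\<bar>s * p + c * q\<bar> * \<bar>\<beta> * ?S\<bar> \<le> sqrt (card E)"
    using abs_sum_derivative_le[where p = p and q = q, OF assms(4) ne sc B B_le m m_le]
    by (simp add: mult.left_commute[of _ \<beta>] sum_distrib_left)
  moreover have "\<beta> * \<bar>s * p + c * q\<bar> * ?S \<le> \<bar>s * p + c * q\<bar> * \<bar>\<beta> * ?S\<bar>"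
    using \<beta> by (simp add: abs_mult mult_left_mono mult_ac)
  ultimately show "\<beta> * \<bar>s * p + c * q\<bar> * ?S \<le> sqrt (card E)" by linarith
qed

theorem theorem1p7:
  fixes V :: "'v set" and E :: "'v set set"
    and M :: "'a measure" and g g' :: "'v set \<Rightarrow> 'a \<Rightarrow> real"
    and \<beta> t :: real
  assumes "finite_graph V E" and "E \<noteq> {}"
    and "\<beta> > 0" and "t > 0"
    and "prob_space M" and "iid_gaussian_pair M E g g'"
  shows "prob_space.expectation M
           (\<lambda>\<omega>. quenched_avg V E \<beta> t (\<lambda>e. g e \<omega>) (\<lambda>e. g' e \<omega>)
              (\<lambda>\<sigma>1 \<sigma>2. (bond_overlap E \<sigma>1 \<sigma>2
                 - quenched_avg V E \<beta> t (\<lambda>e. g e \<omega>) (\<lambda>e. g' e \<omega>) (bond_overlap E))\<^sup>2))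
         \<le> 2 / (\<beta> * exp (- t / 2) * sqrt (t * real (card E)))"
proof -
  have V: "finite V" and edges: "\<And>e. e \<in> E \<Longrightarrow> e \<subseteq> V"
    using assms(1) by (auto simp: finite_graph_def)
  have E: "finite E" using assms(1) by (rule finite_graph_finite_edges)
  define a where "a = exp (- t)"
  define b where "b = sqrt (1 - exp (- 2 * t))"
  have N: "0 < card E" using E assms(2) by (simp add: card_gt_0_iff)
  have exp_lt: "exp (- 2 * t) < 1" using assms(4) by simp
  have b: "0 < b" "b\<^sup>2 = 1 - exp (- 2 * t)" using exp_lt by (auto simp: b_def)
  have ab: "b\<^sup>2 + a\<^sup>2 = 1" using b(2) by (simp add: a_def exp_double[symmetric] mult.commute)
  define m where "m = (\<lambda>v e. gibbs_avg V E \<beta> v (\<lambda>\<sigma>. bond \<sigma> e))"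
  define A where "A = (\<lambda>v e f. gibbs_avg V E \<beta> v (\<lambda>\<sigma>. bond \<sigma> f * bond \<sigma> e))"
  define D where "D = (\<lambda>h e v. \<beta> * (gibbs_avg V E \<beta> v (\<lambda>\<sigma>. h \<sigma> * bond \<sigma> e)
      - gibbs_avg V E \<beta> v h * gibbs_avg V E \<beta> v (\<lambda>\<sigma>. bond \<sigma> e)))"
  have smA: "smooth_bounded E (\<lambda>v. A v e f) (D (\<lambda>\<sigma>. bond \<sigma> f * bond \<sigma> e))"
    and smm: "smooth_bounded E (\<lambda>v. m v e) (D (\<lambda>\<sigma>. bond \<sigma> e))" for e f
    unfolding A_def m_def D_def by (rule smooth_bounded_gibbs_avg[OF V E edges]; assumption)+
  have m_le: "\<bar>m v e\<bar> \<le> 1" if "e \<in> E" for v e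
    unfolding m_def by (rule abs_gibbs_avg_le[OF V]) (simp add: abs_bond[OF _ edges[OF that]])
  have A_le: "\<bar>A v e f\<bar> \<le> 1" if "e \<in> E" "f \<in> E" for v e f
    unfolding A_def by (rule abs_gibbs_avg_le[OF V]) (simp add: abs_mult abs_bond[OF _ edges[OF that(1)]] abs_bond[OF _ edges[OF that(2)]])
  have mm_le: "\<bar>m v f * m v e\<bar> \<le> 1" if "e \<in> E" "f \<in> E" for v e f
    unfolding abs_mult using m_le[OF that(1), of v] m_le[OF that(2), of v] by (intro mult_le_one) auto
  let ?\<gamma> = "gauss_product (E <+> E)"
  let ?u = "lin_comb 1 0 :: ('v set + 'v set \<Rightarrow> real) \<Rightarrow> 'v set \<Rightarrow> real"
  let ?v = "lin_comb a b :: ('v set + 'v set \<Rightarrow> real) \<Rightarrow> 'v set \<Rightarrow> real"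
  let ?T1 = "\<lambda>f e x. A (?v x) e f * (A (?u x) e f - m (?u x) f * m (?u x) e)"
  let ?T2 = "\<lambda>f e x. (m (?u x) f * m (?u x) e) * (A (?v x) e f - m (?v x) f * m (?v x) e)"
  define \<Psi> where "\<Psi> x = (\<Sum>f\<in>E. (\<Sum>e\<in>E. ?T1 f e x) + (\<Sum>e\<in>E. ?T2 f e x)) / (real (card E))\<^sup>2" for x
  txt \<open>In the first term \<open>g\<close> is recovered from the perturbed couplings \<open>h = a g + b g'\<close> by
    \<open>g = a h - b w\<close> with \<open>w = a g' - b g\<close> independent of \<open>h\<close>.\<close>
  have T1: "integrable ?\<gamma> (?T1 f e)" "\<beta> * b * (\<Sum>e\<in>E. \<integral>x. ?T1 f e x \<partial>?\<gamma>) \<le> sqrt (card E)"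
    if "e \<in> E" "f \<in> E" for e f
    using gibbs_decorrelation[where B = "\<lambda>e v. A v e f" and s = "- b" and c = a and p = 1 and q = 0,
        OF V E edges that(2) _ assms(3) smA A_le[OF _ that(2)]] ab b that(1)
    by (simp_all add: A_def m_def)
  \<comment> \<open>Here the prefactor depends on \<open>g\<close> alone, so no rotation is called
    for: \<open>w = g'\<close> is independent of \<open>g\<close> and enters the perturbed couplings
    with coefficient \<open>b\<close>.\<close>
  have T2: "integrable ?\<gamma> (?T2 f e)" "\<beta> * b * (\<Sum>e\<in>E. \<integral>x. ?T2 f e x \<partial>?\<gamma>) \<le> sqrt (card E)"
    if "e \<in> E" "f \<in> E" for e f
    using gibbs_decorrelation[where B = "\<lambda>e v. m v f * m v e" and s = 0 and c = 1 and p = a and q = b,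
        OF V E edges that(2) _ assms(3) smooth_bounded_mult[OF smm smm] mm_le[OF _ that(2)]] b that(1)
    by (simp_all add: A_def m_def)
  define X where "X \<omega> = (\<lambda>i\<in>E <+> E. case_sum g g' i \<omega>)" for \<omega>
  have integrand: "quenched_avg V E \<beta> t (\<lambda>e. g e \<omega>) (\<lambda>e. g' e \<omega>)
              (\<lambda>\<sigma>1 \<sigma>2. (bond_overlap E \<sigma>1 \<sigma>2
                 - quenched_avg V E \<beta> t (\<lambda>e. g e \<omega>) (\<lambda>e. g' e \<omega>) (bond_overlap E))\<^sup>2) = \<Psi> (X \<omega>)" for \<omega>
  proof -
    have "gibbs_avg V E \<beta> (\<lambda>e. g e \<omega>) h = gibbs_avg V E \<beta> (?u (X \<omega>)) h" for h
      by (rule gibbs_avg_cong) (simp add: lin_comb_def X_def InlI)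
    moreover have "gibbs_avg V E \<beta> (perturb t (\<lambda>e. g e \<omega>) (\<lambda>e. g' e \<omega>)) h = gibbs_avg V E \<beta> (?v (X \<omega>)) h" for h
      by (rule gibbs_avg_cong) (simp add: lin_comb_def X_def perturb_def a_def b_def InlI InrI)
    ultimately show ?thesis
      unfolding quenched_variance_bond_overlap[OF V] \<Psi>_def A_def m_def by simp
  qed
  note X = iid_gaussian_pair_distr[OF assms(5,6,2), folded X_def]
  have i\<Psi>: "integrable ?\<gamma> \<Psi>"
    unfolding \<Psi>_def using T1(1) T2(1)
    by (intro integrable_divide_zero Bochner_Integration.integrable_sum Bochner_Integration.integrable_add) auto
  \<comment> \<open>The quenched variance is the function \<open>\<Psi>\<close> of the restricted
    couplings \<open>X\<close>, so a change of variables moves the expectation to the Gaussian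
    product space.\<close>
  have "(\<integral>\<omega>. \<Psi> (X \<omega>) \<partial>M) = (\<integral>x. \<Psi> x \<partial>?\<gamma>)"
  proof -
    have "\<Psi> \<in> borel_measurable (PiM (E <+> E) (\<lambda>_. borel))"
      using borel_measurable_integrable[OF i\<Psi>]
      by (subst (asm) measurable_cong_sets[OF sets_gauss_product refl])
    then show ?thesis
      using integral_distr[OF X(1)] X(2) by metis
  qed
  also have "\<dots> = (\<Sum>f\<in>E. (\<Sum>e\<in>E. \<integral>x. ?T1 f e x \<partial>?\<gamma>) + (\<Sum>e\<in>E. \<integral>x. ?T2 f e x \<partial>?\<gamma>)) / (real (card E))\<^sup>2"
    unfolding \<Psi>_def using T1(1) T2(1) by simp
  also have "\<dots> \<le> (\<Sum>f\<in>E. 2 * sqrt (card E) / (\<beta> * b)) / (real (card E))\<^sup>2"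
  proof (intro divide_right_mono sum_mono)
    fix f assume f: "f \<in> E"
    \<comment> \<open>Both bounds already sum over the first edge, so \<open>f\<close> itself serves
      to discharge that membership premise.\<close>
    have "\<beta> * b * (\<Sum>e\<in>E. \<integral>x. ?T1 f e x \<partial>?\<gamma>) \<le> sqrt (card E)" "\<beta> * b * (\<Sum>e\<in>E. \<integral>x. ?T2 f e x \<partial>?\<gamma>) \<le> sqrt (card E)"
      by (rule T1(2)[OF f f], rule T2(2)[OF f f])
    then have "\<beta> * b * ((\<Sum>e\<in>E. \<integral>x. ?T1 f e x \<partial>?\<gamma>) + (\<Sum>e\<in>E. \<integral>x. ?T2 f e x \<partial>?\<gamma>)) \<le> 2 * sqrt (card E)"
      by (simp only: distrib_left)
    then show "(\<Sum>e\<in>E. \<integral>x. ?T1 f e x \<partial>?\<gamma>) + (\<Sum>e\<in>E. \<integral>x. ?T2 f e x \<partial>?\<gamma>) \<le> 2 * sqrt (card E) / (\<beta> * b)"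
      using assms(3) b(1) by (subst pos_le_divide_eq) (auto simp: mult_ac)
  qed simp
  also have "\<dots> = 2 / (\<beta> * (b * sqrt (card E)))"
  proof -
    have "real (card E) = sqrt (card E) * sqrt (card E)" by simp
    then show ?thesis
      using assms(3) b(1) N by (simp add: field_simps power2_eq_square)
  qed
  also have "\<dots> \<le> 2 / (\<beta> * (exp (- t / 2) * sqrt t * sqrt (card E)))"
  proof (rule divide_left_mono)
    have "(exp (- t / 2) * sqrt t)\<^sup>2 = exp (- t) * t"
      using assms(4) by (simp add: power_mult_distrib exp_double[symmetric])
    \<comment> \<open>This is \<open>1 + t <= exp t\<close> multiplied by
      \<open>exp (- t)\<close>.\<close>
    also have "\<dots> \<le> 1 - exp (- t)"
      using exp_ge_add_one_self[of t] by (simp add: exp_minus field_simps)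
    also have "\<dots> \<le> b\<^sup>2"
      unfolding b(2) using assms(4) by simp
    finally have "exp (- t / 2) * sqrt t \<le> b"
      by (rule power2_le_imp_le) (use b(1) in simp)
    then show "\<beta> * (exp (- t / 2) * sqrt t * sqrt (card E)) \<le> \<beta> * (b * sqrt (card E))"
      using assms(3) by (intro mult_left_mono mult_right_mono) auto
    show "0 < \<beta> * (b * sqrt (card E)) * (\<beta> * (exp (- t / 2) * sqrt t * sqrt (card E)))"
      using assms(3,4) b(1) N by (intro mult_pos_pos) simp_all
  qed simp
  finally show ?thesis
    unfolding integrand by (simp add: real_sqrt_mult mult.assoc)
qed

end
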